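(* Let $m\geq 1$, $b\geq 2$ be integers, let $W_1,\ldots,W_m\subseteq \{0,1,\ldots,b-1\}$ with $|W_i|\geq 2$, and let $K=C_{b,W_1}\times\cdots\times C_{b,W_m}$, where $C_{b,W}$ denotes the missing digit Cantor set of real numbers $\xi=\sum_{i\geq 1}a_ib^{-i}$ with all $a_i\in W$. Assume $0\in W_i$ for all $1\leq i\leq m$. Write $d_i= \log |W_i|/\log b$ for $1\leq i\leq m$ (the Hausdorff = packing dimension of $C_{b,W_i}$). Then $\dim_H(\mathcal{S}_m^{(b)\ast}\cap K)$ is bounded from below by the maximum of the function \[ t\longmapsto \sum_{i=1}^{m} d_i \cdot \frac{ -wt^2 + (w+1)t -1 }{ (w+1)(1-d_i) t^2 + ((w+2)d_i -1) t - d_i } \] over $t>1$, where $w=1/m$. If $K=C_{3,\{0,2\}}\times C_{3,\{0,2\}}$ (product of two copies of Cantor's middle third set), then \[ \dim_H(\mathcal{S}_2^{\ast}\cap K)\geq \dim_H(\mathcal{S}_2^{(3)\ast}\cap K) > 0.1255. \] If we drop the assumption $0\in W_i$, the estimates remain true for the non-$b$-ary sets $\mathcal{S}_m^{\ast}\cap K$.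
   Context: Fix any norm $\Vert\cdot\Vert$ on $\mathbb{R}^m$. A vector $\underline{\xi}=(\xi_1,\ldots,\xi_m)$ is totally irrational if $\{1,\xi_1,\ldots,\xi_m\}$ is $\mathbb{Q}$-linearly independent. For $w\in[0,1)$, $\mathcal{S}_m^{\ast}(w)$ is the set of totally irrational $\underline{\xi}\in\mathbb{R}^m$ such that for every $c>0$ and all sufficiently large $Q$ the system $1\leq q\leq Q$, $\Vert q\underline{\xi}-\underline{p}\Vert\leq cQ^{-w}$ has a solution in integers $(q,\underline{p})=(q,p_1,\ldots,p_m)$; $\mathcal{S}_m^{(b)\ast}(w)$ is defined in the same way but restricting $q$ to integer powers $q=b^N$ of $b$. Further $\mathcal{S}_m^{\ast}=\mathcal{S}_m^{\ast}(1/m)$ and $\mathcal{S}_m^{(b)\ast}=\mathcal{S}_m^{(b)\ast}(1/m)$ (singular, resp. $b$-ary singular, totally irrational vectors). *)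

theory Defs
  imports "HOL-Analysis.Analysis"
begin

text \<open>
  The Hausdorff measure, with arbitrary countable covers.  The convention \<open>0 powr 0 = 0\<close> makes
  the value at \<open>s = 0\<close> differ from the counting measure, so the dimension below ranges over
  \<open>s > 0\<close> only; this does not change the infimum.  Boundedness is required explicitly because
  the library's \<open>diameter\<close> is \<open>0\<close> on unbounded sets.
\<close>

definition hausdorff_premeasure :: "real \<Rightarrow> real \<Rightarrow> 'a::metric_space set \<Rightarrow> ennreal" where
  "hausdorff_premeasure s \<delta> A =
     (INF U \<in> {U :: nat \<Rightarrow> 'a set. A \<subseteq> (\<Union>i. U i) \<and> (\<forall>i. bounded (U i) \<and> diameter (U i) \<le> \<delta>)}.
        (\<Sum>i. ennreal (diameter (U i) powr s)))"

definition hausdorff_measure :: "real \<Rightarrow> 'a::metric_space set \<Rightarrow> ennreal" where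
  "hausdorff_measure s A = (SUP \<delta> \<in> {0<..}. hausdorff_premeasure s \<delta> A)"

definition hausdorff_dim :: "'a::metric_space set \<Rightarrow> ereal" where
  "hausdorff_dim A = (INF s \<in> {s. 0 < s \<and> hausdorff_measure s A = 0}. ereal s)"

definition is_norm :: "('a::real_vector \<Rightarrow> real) \<Rightarrow> bool" where
  "is_norm N \<longleftrightarrow>
     (\<forall>x. 0 \<le> N x) \<and> (\<forall>x. N x = 0 \<longleftrightarrow> x = 0) \<and>
     (\<forall>r x. N (r *\<^sub>R x) = \<bar>r\<bar> * N x) \<and> (\<forall>x y. N (x + y) \<le> N x + N y)"

text \<open>
  Rational linear independence of \<open>1, \<xi>\<^sub>1, \<dots>, \<xi>\<^sub>m\<close> as a family, so repeated entries are dependent.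
\<close>

definition totally_irrational :: "real ^ 'm \<Rightarrow> bool" where
  "totally_irrational \<xi> \<longleftrightarrow>
     (\<forall>(r :: rat) (a :: 'm \<Rightarrow> rat).
        of_rat r + (\<Sum>i\<in>UNIV. of_rat (a i) * \<xi> $ i) = 0 \<longrightarrow> r = 0 \<and> (\<forall>i. a i = 0))"

text \<open>
  In the following, \<open>D\<close> is the set of admissible denominators, \<open>N\<close> is the chosen norm, and
  \<open>w\<close> is the exponent.
\<close>

definition singular_with :: "int set \<Rightarrow> (real ^ 'm \<Rightarrow> real) \<Rightarrow> real \<Rightarrow> (real ^ 'm) set" where
  "singular_with D N w =
     {\<xi>. totally_irrational \<xi> \<and>
        (\<forall>c>0. \<forall>\<^sub>F Q :: real in at_top.
           \<exists>q\<in>D. \<exists>p :: int ^ 'm. 1 \<le> q \<and> of_int q \<le> Q \<and>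
             N (of_int q *\<^sub>R \<xi> - (\<chi> i. of_int (p $ i))) \<le> c * Q powr (- w))}"

definition S_star :: "(real ^ 'm \<Rightarrow> real) \<Rightarrow> (real ^ 'm) set" where
  "S_star N = singular_with UNIV N (1 / real CARD('m))"

definition S_star_ary :: "nat \<Rightarrow> (real ^ 'm \<Rightarrow> real) \<Rightarrow> (real ^ 'm) set" where
  "S_star_ary b N = singular_with {int b ^ n | n :: nat. True} N (1 / real CARD('m))"

text \<open>The sequence \<open>a\<close> is indexed from \<open>0\<close>, so \<open>a i\<close> is the digit at \<open>b\<close> to the power \<open>-(i+1)\<close>.\<close>

definition missing_digit_set :: "nat \<Rightarrow> nat set \<Rightarrow> real set" where
  "missing_digit_set b W =
     {x. \<exists>a :: nat \<Rightarrow> nat. (\<forall>i. a i \<in> W) \<and> (\<lambda>i. real (a i) / real b ^ Suc i) sums x}"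

definition missing_digit_product :: "nat \<Rightarrow> ('m \<Rightarrow> nat set) \<Rightarrow> (real ^ 'm) set" where
  "missing_digit_product b W = {\<xi>. \<forall>i. \<xi> $ i \<in> missing_digit_set b (W i)}"

definition digit_dim :: "nat \<Rightarrow> nat set \<Rightarrow> real" where
  "digit_dim b W = ln (real (card W)) / ln (real b)"

definition bound_fun :: "real \<Rightarrow> ('m::finite \<Rightarrow> real) \<Rightarrow> real \<Rightarrow> real" where
  "bound_fun w d t =
     (\<Sum>i\<in>UNIV. d i * ((- w * t\<^sup>2 + (w + 1) * t - 1) /
        ((w + 1) * (1 - d i) * t\<^sup>2 + ((w + 2) * d i - 1) * t - d i)))"

end

theory Submission
  imports Defs "HOL-Probability.Infinite_Product_Measure"
begin

text \<open>
  Choose block starts \<open>n\<^sub>k\<close> growing like \<open>T ^ k\<close> and fix, in every coordinate \<open>i\<close>, all digits with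
  index in \<open>[n\<^sub>k, s n\<^sub>k)\<close> to be a constant \<open>e\<^sub>i \<in> W\<^sub>i\<close>; the other digits are chosen freely.  Then
  \<open>b ^ n\<^sub>k\<close> (times \<open>b - 1\<close> if some \<open>e\<^sub>i\<close> is not \<open>0\<close>) solves the system for all \<open>Q\<close> up to
  \<open>b ^ n\<^sub>k\<^sub>+\<^sub>1\<close> as soon as \<open>s > 1 + w T\<close>.  Choosing the free digits independently and uniformly gives
  a probability measure that vanishes on hyperplanes, so almost every point is totally irrational,
  and whose decay on small sets is governed by the proportion of free digits, which is smallest at
  the ends of the blocks.  The mass distribution principle gives the lower bound
  \<open>(T - s) / ((T - 1) s)\<close> times the sum of the \<open>d\<^sub>i\<close>.  With \<open>s\<close> tending to \<open>1 + w T\<close> and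
  \<open>t = T / s\<close> this is the claimed bound without the factors
  \<open>t - d\<^sub>i (t - 1) \<ge> 1\<close> of its denominators.
\<close>

section \<open>Digit expansions and random digits\<close>

definition expansion :: "nat \<Rightarrow> (nat \<Rightarrow> nat) \<Rightarrow> real" where
  "expansion b a = (\<Sum>i. real (a i) / real b ^ Suc i)"

text \<open>For digits below \<open>b\<close> this is \<open>b ^ n * expansion b a\<close> up to an
  error of at most 1. Encoding the first \<open>n\<close> digits as one natural number turns
  cylinders into level sets, so that counting cylinders near a real becomes counting integers in an
  interval.\<close>

primrec digit_prefix :: "nat \<Rightarrow> nat \<Rightarrow> (nat \<Rightarrow> nat) \<Rightarrow> nat" where
  "digit_prefix b 0 a = 0"
| "digit_prefix b (Suc n) a = b * digit_prefix b n a + a n"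

lemma geometric_digit_sums:
  assumes "b \<ge> 2"
  shows "(\<lambda>i. (real b - 1) / real b ^ Suc i) sums 1"
proof -
  have "(\<lambda>i. (1 / real b) ^ i) sums (1 / (1 - 1 / real b))"
    using assms by (intro geometric_sums) auto
  from sums_mult[OF this, of "(real b - 1) / real b"]
  show ?thesis using assms by (simp add: field_simps power_divide)
qed

text \<open>The coefficients are real and signed, so that differences of digits are covered as well
  as digits.\<close>

lemma bounded_digits_summable:
  fixes c :: "nat \<Rightarrow> real"
  assumes "b \<ge> 2" "\<And>i. \<bar>c i\<bar> \<le> real b - 1"
  shows "summable (\<lambda>i. c i / real b ^ Suc i)"
proof (rule summable_comparison_test'[of "\<lambda>i. (real b - 1) / real b ^ Suc i" 0])
  show "summable (\<lambda>i. (real b - 1) / real b ^ Suc i)"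
    using geometric_digit_sums[OF assms(1)] by (rule sums_summable)
  show "norm (c i / real b ^ Suc i) \<le> (real b - 1) / real b ^ Suc i" for i
    using assms(2)[of i] assms(1) by (simp add: divide_right_mono)
qed

lemma bounded_digits_suminf_le:
  fixes c :: "nat \<Rightarrow> real"
  assumes "b \<ge> 2" "\<And>i. \<bar>c i\<bar> \<le> real b - 1"
  shows "\<bar>\<Sum>i. c i / real b ^ Suc i\<bar> \<le> 1"
proof -
  have "norm (\<Sum>i. c i / real b ^ Suc i) \<le> (\<Sum>i. (real b - 1) / real b ^ Suc i)"
  proof (rule norm_suminf_le)
    show "summable (\<lambda>i. (real b - 1) / real b ^ Suc i)"
      using geometric_digit_sums[OF assms(1)] by (rule sums_summable)
    show "norm (c i / real b ^ Suc i) \<le> (real b - 1) / real b ^ Suc i" for i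
      using assms(2)[of i] assms(1) by (simp add: divide_right_mono)
  qed
  then show ?thesis
    using sums_unique[OF geometric_digit_sums[OF assms(1)]] by simp
qed

text \<open>For integer coefficients the first sum is an integer, and the second is a tail of size
  at most 1. Both the prefix estimate and the rational approximation rest on this splitting.\<close>

lemma bounded_digits_shift:
  fixes c :: "nat \<Rightarrow> real"
  assumes b: "b \<ge> 2" and c: "\<And>i. \<bar>c i\<bar> \<le> real b - 1"
  shows "real b ^ n * (\<Sum>i. c i / real b ^ Suc i) =
    (\<Sum>i<n. c i * real b ^ (n - Suc i)) + (\<Sum>i. c (i + n) / real b ^ Suc i)"
proof -
  have "(\<Sum>i. c i / real b ^ Suc i) = (\<Sum>i. c (i + n) / real b ^ Suc (i + n)) + (\<Sum>i<n. c i / real b ^ Suc i)"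
    by (rule suminf_split_initial_segment[OF bounded_digits_summable[OF b c]])
  moreover have "real b ^ n * (\<Sum>i. c (i + n) / real b ^ Suc (i + n)) = (\<Sum>i. c (i + n) / real b ^ Suc i)"
    using b
    by (subst suminf_mult[OF summable_ignore_initial_segment[OF bounded_digits_summable[OF b c]], symmetric])
       (simp add: power_add mult.assoc)
  moreover have "real b ^ n * (\<Sum>i<n. c i / real b ^ Suc i) = (\<Sum>i<n. c i * real b ^ (n - Suc i))"
    unfolding sum_distrib_left
  proof (rule sum.cong)
    fix i assume "i \<in> {..<n}"
    then have "real b ^ n = real b ^ (n - Suc i) * real b ^ Suc i"
      by (simp flip: power_add power_Suc)
    then show "real b ^ n * (c i / real b ^ Suc i) = c i * real b ^ (n - Suc i)"
      using b by simp
  qed simp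
  ultimately show ?thesis by (simp add: distrib_left)
qed

lemma digit_prefix_eq_sum: "digit_prefix b n a = (\<Sum>i<n. a i * b ^ (n - Suc i))"
proof (induction n)
  case (Suc n)
  have "b * (\<Sum>i<n. a i * b ^ (n - Suc i)) = (\<Sum>i<n. a i * b ^ (n - i))"
    unfolding sum_distrib_left
  proof (rule sum.cong)
    fix i assume "i \<in> {..<n}"
    then have "b * b ^ (n - Suc i) = b ^ (n - i)"
      by (metis Suc_diff_Suc lessThan_iff power_Suc)
    then show "b * (a i * b ^ (n - Suc i)) = a i * b ^ (n - i)"
      by (metis mult.left_commute)
  qed simp
  then show ?case using Suc by simp
qed simp

lemma digit_abs_le: "a < b \<Longrightarrow> \<bar>real a\<bar> \<le> real b - 1"
  by linarith

lemma expansion_digit_prefix: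
  assumes b: "b \<ge> 2" and a: "\<And>i. a i < b"
  shows "\<bar>real b ^ n * expansion b a - real (digit_prefix b n a)\<bar> \<le> 1"
proof -
  have "real b ^ n * expansion b a = real (digit_prefix b n a) + (\<Sum>i. real (a (i + n)) / real b ^ Suc i)"
    using bounded_digits_shift[of b "\<lambda>i. real (a i)" n, OF b digit_abs_le[OF a]]
    by (simp add: expansion_def digit_prefix_eq_sum)
  moreover have "\<bar>\<Sum>i. real (a (i + n)) / real b ^ Suc i\<bar> \<le> 1"
    by (rule bounded_digits_suminf_le[OF b digit_abs_le[OF a]])
  ultimately show ?thesis by simp
qed

lemma digit_prefix_eq_iff:
  assumes "\<And>i. a i < b" "\<And>i. a' i < b"
  shows "digit_prefix b n a = digit_prefix b n a' \<longleftrightarrow> (\<forall>i<n. a i = a' i)"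
proof (induction n)
  case (Suc n)
  have "digit_prefix b (Suc n) a = digit_prefix b (Suc n) a' \<longleftrightarrow>
      digit_prefix b n a = digit_prefix b n a' \<and> a n = a' n" (is "?L = ?R")
  proof
    assume ?L
    \<comment> \<open>Reduction modulo \<open>b\<close> isolates the last digit.\<close>
    then have "(a n + b * digit_prefix b n a) mod b = (a' n + b * digit_prefix b n a') mod b"
      by (simp add: add.commute)
    then have "a n = a' n" using assms by simp
    with \<open>?L\<close> show ?R using assms(1)[of n] by simp
  qed simp
  then show ?case using Suc by (auto simp: less_Suc_eq)
qed simp

text \<open>Writing each digit as \<open>e + (a j - e)\<close>, a block of digits \<open>e\<close> leaves only a tail of size
  \<open>b ^ -(z - n)\<close> beyond the rational number \<open>e / (b - 1)\<close>.\<close>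

lemma expansion_block_approx:
  assumes b: "b \<ge> 2" and a: "\<And>i. a i < b" and e: "e < b"
    and g: "(b - 1) dvd g * e"
    and block: "\<And>j. n \<le> j \<Longrightarrow> j < z \<Longrightarrow> a j = e" and nz: "n \<le> z"
  shows "\<exists>p :: int. \<bar>real g * real b ^ n * expansion b a - of_int p\<bar> \<le> real g * real b powr (real n - real z)"
proof -
  define c where "c i = real (a i) - real e" for i
  have c: "\<bar>c i\<bar> \<le> real b - 1" for i
    using digit_abs_le[OF a[of i]] digit_abs_le[OF e] by (auto simp: c_def)
  have c0: "c j = 0" if "n \<le> j" "j < z" for j
    using block[OF that] by (simp add: c_def)
  have "(\<lambda>i. real e / (real b - 1) * ((real b - 1) / real b ^ Suc i)) sums (real e / (real b - 1) * 1)"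
    by (rule sums_mult[OF geometric_digit_sums[OF b]])
  then have "(\<lambda>i. real e / real b ^ Suc i) sums (real e / (real b - 1))"
    using b by simp
  from sums_add[OF this summable_sums[OF bounded_digits_summable[OF b c]]]
  have "expansion b a = real e / (real b - 1) + (\<Sum>i. c i / real b ^ Suc i)"
    unfolding expansion_def c_def by (simp add: sums_iff add_divide_distrib[symmetric])
  then have 1: "real b ^ n * expansion b a = real b ^ n * (real e / (real b - 1)) +
      (\<Sum>i<n. c i * real b ^ (n - Suc i)) + (\<Sum>i. c (i + n) / real b ^ Suc i)"
    using bounded_digits_shift[OF b c, of n] by (simp add: distrib_left)
  \<comment> \<open>The tail starting at \<open>n\<close> is shifted once more, by the length of the
    block. Since \<open>c\<close> vanishes on the block, no integer part appears and only the tail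
    after \<open>z\<close> survives.\<close>
  have "real b ^ (z - n) * (\<Sum>i. c (i + n) / real b ^ Suc i) = (\<Sum>i. c (i + z) / real b ^ Suc i)"
    using bounded_digits_shift[of b "\<lambda>i. c (i + n)" "z - n", OF b c] nz c0 by simp
  moreover have "\<bar>\<Sum>i. c (i + z) / real b ^ Suc i\<bar> \<le> 1"
    by (rule bounded_digits_suminf_le[OF b c])
  ultimately have "\<bar>real b ^ (z - n) * (\<Sum>i. c (i + n) / real b ^ Suc i)\<bar> \<le> 1"
    by simp
  then have "real b ^ (z - n) * \<bar>\<Sum>i. c (i + n) / real b ^ Suc i\<bar> \<le> 1"
    unfolding abs_mult by simp
  then have 2: "\<bar>\<Sum>i. c (i + n) / real b ^ Suc i\<bar> \<le> real b powr (real n - real z)"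
    using b nz by (simp add: powr_diff powr_realpow power_diff field_simps)
  obtain h where h: "g * e = (b - 1) * h" using g by (auto elim: dvdE)
  then have h': "real g * real e = (real b - 1) * real h"
    using b by (simp add: of_nat_diff flip: of_nat_mult)
      (simp add: of_nat_diff)
  \<comment> \<open>Multiplication by \<open>g\<close> turns the periodic value
    \<open>e / (b - 1)\<close> into the integer \<open>h\<close>; the second summand is the head of
    the shifted series of differences.\<close>
  define p :: int where
    "p = int h * int b ^ n + int g * (\<Sum>i<n. (int (a i) - int e) * int b ^ (n - Suc i))"
  have "real g * real b ^ n * expansion b a - of_int p = real g * (\<Sum>i. c (i + n) / real b ^ Suc i)"
  proof -
    have "real g * (real e / (real b - 1)) = real h"
      using h' b by (simp add: field_simps)
    then have "real g * (real b ^ n * (real e / (real b - 1))) = real h * real b ^ n"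
      by (simp only: mult.left_commute[of "real g"] mult.commute)
    then show ?thesis
      by (simp add: mult.assoc 1 p_def distrib_left c_def)
  qed
  then have "\<bar>real g * real b ^ n * expansion b a - of_int p\<bar> \<le> real g * real b powr (real n - real z)"
    using 2 by (simp add: abs_mult mult_left_mono)
  then show ?thesis by blast
qed

lemma expansion_mem_missing_digit_set:
  assumes "b \<ge> 2" "\<And>i. a i \<in> W" "W \<subseteq> {0..<b}"
  shows "expansion b a \<in> missing_digit_set b W"
proof -
  have "a i < b" for i using assms(2,3) by (meson atLeastLessThan_iff subsetD)
  then have "(\<lambda>i. real (a i) / real b ^ Suc i) sums expansion b a"
    unfolding expansion_def
    by (intro summable_sums bounded_digits_summable assms digit_abs_le)
  with assms(2) show ?thesis unfolding missing_digit_set_def by blast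
qed

section \<open>The law of independent uniform digits\<close>

definition digit_measure :: "(nat \<Rightarrow> nat set) \<Rightarrow> (nat \<Rightarrow> nat) measure" where
  "digit_measure A = (\<Pi>\<^sub>M j\<in>UNIV. uniform_count_measure (A j))"

lemma space_digit_measure: "space (digit_measure A) = {\<omega>. \<forall>j. \<omega> j \<in> A j}"
  by (auto simp: digit_measure_def space_PiM space_uniform_count_measure)

text \<open>The digit set may depend on the position: a singleton forces the digit there, a larger
  set leaves a uniform choice.\<close>

locale digit_sets =
  fixes b :: nat and A :: "nat \<Rightarrow> nat set"
  assumes b: "b \<ge> 2" and nonempty: "\<And>j. A j \<noteq> {}" and digits: "\<And>j. A j \<subseteq> {0..<b}"
begin

lemma finite_A: "finite (A j)"
  by (rule finite_subset[OF digits]) simp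

lemma prob_uniform: "prob_space (uniform_count_measure (A j))"
  using prob_space_uniform_count_measure[OF finite_A nonempty] .

sublocale product_prob_space "\<lambda>j. uniform_count_measure (A j)" UNIV
  by (rule product_prob_spaceI) (rule prob_uniform)

lemma prob_digit_measure: "prob_space (digit_measure A)"
  unfolding digit_measure_def by (rule P.prob_space_axioms)

lemma digit_less: "\<omega> \<in> space (digit_measure A) \<Longrightarrow> \<omega> j < b"
  using digits[of j] by (auto simp: space_digit_measure)

lemma measurable_digit: "(\<lambda>\<omega>. \<omega> j) \<in> digit_measure A \<rightarrow>\<^sub>M count_space UNIV"
proof -
  have "(\<lambda>\<omega>. \<omega> j) \<in> digit_measure A \<rightarrow>\<^sub>M uniform_count_measure (A j)"
    unfolding digit_measure_def by measurable
  then have "(\<lambda>\<omega>. \<omega> j) \<in> digit_measure A \<rightarrow>\<^sub>M count_space (A j)"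
    using measurable_cong_sets[OF refl sets_uniform_count_measure_count_space] by blast
  from measurable_compose[OF this, of "\<lambda>x. x" "count_space UNIV"]
  show ?thesis by simp
qed

lemma measurable_expansion: "expansion b \<in> borel_measurable (digit_measure A)"
proof -
  have "(\<lambda>\<omega>. \<Sum>i. real (\<omega> i) / real b ^ Suc i) \<in> borel_measurable (digit_measure A)"
    by (intro borel_measurable_suminf borel_measurable_divide borel_measurable_const
        measurable_compose[OF measurable_digit]) simp
  then show ?thesis unfolding expansion_def[abs_def] .
qed

lemma prefix_set_measurable: "{\<omega> \<in> space (digit_measure A). digit_prefix b n \<omega> = k} \<in> sets (digit_measure A)"
proof -
  have "digit_prefix b n \<in> digit_measure A \<rightarrow>\<^sub>M count_space UNIV"
  proof (induction n)
    case (Suc n)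
    have "(\<lambda>\<omega>. (digit_prefix b n \<omega>, \<omega> n)) \<in> digit_measure A \<rightarrow>\<^sub>M count_space UNIV \<Otimes>\<^sub>M count_space UNIV"
      by (rule measurable_Pair[OF Suc measurable_digit])
    then have "(\<lambda>\<omega>. (digit_prefix b n \<omega>, \<omega> n)) \<in> digit_measure A \<rightarrow>\<^sub>M count_space UNIV"
      by (simp add: pair_measure_countable)
    from measurable_compose[OF this, of "\<lambda>(k, a). b * k + a" "count_space UNIV"]
    show ?case by simp
  qed simp
  then show ?thesis by measurable
qed

text \<open>A nonempty level set of the prefix is the cylinder around any of its members, and
  independence gives its mass as a product. An empty one has mass 0, hence the inequality.\<close>

lemma emeasure_prefix:
  "emeasure (digit_measure A) {\<omega> \<in> space (digit_measure A). digit_prefix b n \<omega> = k}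
    \<le> ennreal (\<Prod>j<n. 1 / real (card (A j)))" (is "emeasure _ ?C \<le> _")
proof (cases "?C = {}")
  case False
  then obtain \<omega>0 where \<omega>0: "\<omega>0 \<in> space (digit_measure A)" "digit_prefix b n \<omega>0 = k" by blast
  have "?C = {\<omega> \<in> space (PiM UNIV (\<lambda>j. uniform_count_measure (A j))). \<forall>j\<in>{..<n}. \<omega> j \<in> {\<omega>0 j}}"
    (is "_ = ?D")
  proof -
    have "digit_prefix b n \<omega> = k \<longleftrightarrow> (\<forall>j<n. \<omega> j = \<omega>0 j)" if "\<omega> \<in> space (digit_measure A)" for \<omega>
      using digit_prefix_eq_iff[of \<omega> b \<omega>0 n, OF digit_less[OF that] digit_less[OF \<omega>0(1)]] \<omega>0(2) by simp
    then show ?thesis by (auto simp flip: digit_measure_def)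
  qed
  also have "emeasure (digit_measure A) ?D = (\<Prod>j<n. emeasure (uniform_count_measure (A j)) {\<omega>0 j})"
    unfolding digit_measure_def using \<omega>0(1)
    by (intro emeasure_PiM_Collect) (auto simp: sets_uniform_count_measure space_digit_measure)
  also have "\<dots> = (\<Prod>j<n. ennreal (1 / real (card (A j))))"
    using \<omega>0(1) by (intro prod.cong refl) (auto simp: emeasure_uniform_count_measure finite_A space_digit_measure)
  also have "\<dots> = ennreal (\<Prod>j<n. 1 / real (card (A j)))"
    by (rule prod_ennreal) simp
  finally show ?thesis by simp
next
  case True
  show ?thesis unfolding True by simp
qed

lemma near_set_measurable:
  "{\<omega> \<in> space (digit_measure A). \<bar>expansion b \<omega> - p\<bar> \<le> r} \<in> sets (digit_measure A)"
proof -
  note [measurable] = measurable_expansion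
  show ?thesis by measurable
qed

text \<open>After scaling by \<open>b ^ n\<close> the expansion is within 1 of
  \<open>b ^ n * p\<close> and within 1 of its prefix. The prefix thus lies in an interval of length
  4, which contains at most five integers, and each of them contributes at most the mass of one
  cylinder.\<close>

lemma emeasure_near:
  assumes r: "r * real b ^ n \<le> 1"
  shows "emeasure (digit_measure A) {\<omega> \<in> space (digit_measure A). \<bar>expansion b \<omega> - p\<bar> \<le> r}
    \<le> ennreal (5 * (\<Prod>j<n. 1 / real (card (A j))))"
proof -
  define y where "y = real b ^ n * p"
  define I where "I = nat ` {\<lceil>y - 2\<rceil>..\<lfloor>y + 2\<rfloor>}"
  let ?C = "\<lambda>k. {\<omega> \<in> space (digit_measure A). digit_prefix b n \<omega> = k}"
  have "card {\<lceil>y - 2\<rceil>..\<lfloor>y + 2\<rfloor>} \<le> 5" by simp linarith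
  then have card: "card I \<le> 5"
    unfolding I_def by (meson card_image_le finite_atLeastAtMost_int le_trans)
  have "{\<omega> \<in> space (digit_measure A). \<bar>expansion b \<omega> - p\<bar> \<le> r} \<subseteq> (\<Union>k\<in>I. ?C k)"
  proof (intro subsetI)
    fix \<omega> assume "\<omega> \<in> {\<omega> \<in> space (digit_measure A). \<bar>expansion b \<omega> - p\<bar> \<le> r}"
    then have \<omega>: "\<omega> \<in> space (digit_measure A)" and near: "\<bar>expansion b \<omega> - p\<bar> \<le> r" by auto
    have "real b ^ n * \<bar>expansion b \<omega> - p\<bar> \<le> real b ^ n * r" using near by (simp add: mult_left_mono)
    then have "\<bar>real b ^ n * expansion b \<omega> - y\<bar> \<le> 1"
      using r by (simp add: y_def abs_mult flip: right_diff_distrib) (simp add: mult.commute)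
    moreover have "\<bar>real b ^ n * expansion b \<omega> - real (digit_prefix b n \<omega>)\<bar> \<le> 1"
      by (rule expansion_digit_prefix[OF b digit_less[OF \<omega>]])
    ultimately have "\<bar>real (digit_prefix b n \<omega>) - y\<bar> \<le> 2" by linarith
    then have "int (digit_prefix b n \<omega>) \<in> {\<lceil>y - 2\<rceil>..\<lfloor>y + 2\<rfloor>}"
      unfolding atLeastAtMost_iff ceiling_le_iff le_floor_iff by (simp add: abs_le_iff)
    then have "digit_prefix b n \<omega> \<in> I" unfolding I_def by force
    with \<omega> show "\<omega> \<in> (\<Union>k\<in>I. ?C k)" by blast
  qed
  then have "emeasure (digit_measure A) {\<omega> \<in> space (digit_measure A). \<bar>expansion b \<omega> - p\<bar> \<le> r}
      \<le> emeasure (digit_measure A) (\<Union>k\<in>I. ?C k)"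
    by (intro emeasure_mono sets.finite_UN prefix_set_measurable) (auto simp: I_def)
  also have "\<dots> \<le> (\<Sum>k\<in>I. emeasure (digit_measure A) (?C k))"
    by (intro emeasure_subadditive_finite) (auto simp: I_def prefix_set_measurable)
  also have "\<dots> \<le> (\<Sum>k\<in>I. ennreal (\<Prod>j<n. 1 / real (card (A j))))"
    by (intro sum_mono emeasure_prefix)
  also have "\<dots> = ennreal (real (card I) * (\<Prod>j<n. 1 / real (card (A j))))"
    by (simp add: ennreal_mult prod_nonneg ennreal_of_nat_eq_real_of_nat)
  also have "\<dots> \<le> ennreal (5 * (\<Prod>j<n. 1 / real (card (A j))))"
    using card by (intro ennreal_leI mult_right_mono prod_nonneg) auto
  finally show ?thesis .
qed

end

section \<open>Hausdorff dimension and random points\<close>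

lemma hausdorff_premeasure_mono:
  "A \<subseteq> B \<Longrightarrow> hausdorff_premeasure s \<delta> A \<le> hausdorff_premeasure s \<delta> B"
  unfolding hausdorff_premeasure_def by (rule INF_superset_mono) auto

lemma hausdorff_measure_mono:
  "A \<subseteq> B \<Longrightarrow> hausdorff_measure s A \<le> hausdorff_measure s B"
  unfolding hausdorff_measure_def by (intro SUP_mono' hausdorff_premeasure_mono)

lemma hausdorff_dim_mono:
  assumes "A \<subseteq> B" shows "hausdorff_dim A \<le> hausdorff_dim B"
  unfolding hausdorff_dim_def
proof (rule INF_superset_mono)
  have "hausdorff_measure s A = 0" if "hausdorff_measure s B = 0" for s
    using hausdorff_measure_mono[OF assms, of s] that by simp
  then show "{s. 0 < s \<and> hausdorff_measure s B = 0} \<subseteq> {s. 0 < s \<and> hausdorff_measure s A = 0}"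
    by blast
qed simp

lemma hausdorff_dim_nonneg: "0 \<le> hausdorff_dim A"
  unfolding hausdorff_dim_def by (rule INF_greatest) auto

text \<open>If the dimension were below \<sigma>, then for some \<open>s < \<sigma>\<close> a cover
  with very small sum of \<open>diameter powr s\<close> would exist. Its preimages would carry all
  of \<open>M\<close> although their total mass is below 1. The preimage of \<open>U\<close> is
  enclosed in a measurable \<open>C\<close> because covering sets are arbitrary.\<close>

lemma mass_distribution:
  fixes S :: "'a::metric_space set" and \<sigma> \<kappa> \<delta>0 :: real
  assumes "prob_space M" and S: "AE \<omega> in M. X \<omega> \<in> S" and "\<delta>0 > 0" and "\<kappa> \<ge> 0"
    and cover: "\<And>U. bounded U \<Longrightarrow> diameter U \<le> \<delta>0 \<Longrightarrow>
      \<exists>C\<in>sets M. {\<omega>\<in>space M. X \<omega> \<in> U} \<subseteq> C \<and> emeasure M C \<le> ennreal (\<kappa> * diameter U powr \<sigma>)"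
  shows "ereal \<sigma> \<le> hausdorff_dim S"
  unfolding hausdorff_dim_def
proof (rule INF_greatest, rule ccontr)
  interpret prob_space M by fact
  fix s assume "s \<in> {s. 0 < s \<and> hausdorff_measure s S = 0}" "\<not> ereal \<sigma> \<le> ereal s"
  then have s: "0 < s" "s < \<sigma>" and H: "hausdorff_measure s S = 0" by auto
  \<comment> \<open>With diameters at most 1, the power with the larger exponent \<sigma> is the
    smaller one.\<close>
  define \<delta> where "\<delta> = min \<delta>0 1"
  have \<delta>: "\<delta> > 0" using assms(3) by (simp add: \<delta>_def)
  \<comment> \<open>The added 1 keeps \<open>k\<close> positive, so that the threshold
    \<open>1 / k\<close> makes sense for \<kappa> equal to 0 too.\<close>
  define k where "k = \<kappa> + 1"
  have k: "k > 0" using assms(4) by (simp add: k_def)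
  have "hausdorff_premeasure s \<delta> S \<le> hausdorff_measure s S"
    unfolding hausdorff_measure_def using \<delta> by (intro SUP_upper) auto
  then have "hausdorff_premeasure s \<delta> S < ennreal (1 / k)" using H k by simp
  then obtain U :: "nat \<Rightarrow> 'a set" where U: "S \<subseteq> (\<Union>i. U i)" "\<And>i. bounded (U i)" "\<And>i. diameter (U i) \<le> \<delta>"
    and sum: "(\<Sum>i. ennreal (diameter (U i) powr s)) < ennreal (1 / k)"
    unfolding hausdorff_premeasure_def INF_less_iff by blast
  have "\<exists>C\<in>sets M. {\<omega>\<in>space M. X \<omega> \<in> U i} \<subseteq> C \<and> emeasure M C \<le> ennreal (\<kappa> * diameter (U i) powr \<sigma>)" for i
    using U(2,3)[of i] by (intro cover) (auto simp: \<delta>_def)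
  then obtain C where C: "\<And>i. C i \<in> sets M" "\<And>i. {\<omega>\<in>space M. X \<omega> \<in> U i} \<subseteq> C i"
      "\<And>i. emeasure M (C i) \<le> ennreal (\<kappa> * diameter (U i) powr \<sigma>)"
    by metis
  have C': "emeasure M (C i) \<le> ennreal k * ennreal (diameter (U i) powr s)" for i
  proof -
    have "0 \<le> diameter (U i)" "diameter (U i) \<le> 1"
      using U(2,3)[of i] by (auto simp: \<delta>_def diameter_ge_0)
    then have "diameter (U i) powr \<sigma> \<le> diameter (U i) powr s"
      using s by (cases "diameter (U i) = 0") (auto intro: powr_mono')
    then have "\<kappa> * diameter (U i) powr \<sigma> \<le> k * diameter (U i) powr s"
      using assms(4) unfolding k_def by (intro mult_mono) auto
    then have "ennreal (\<kappa> * diameter (U i) powr \<sigma>) \<le> ennreal (k * diameter (U i) powr s)"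
      by (rule ennreal_leI)
    also have "\<dots> = ennreal k * ennreal (diameter (U i) powr s)" using k by (simp add: ennreal_mult)
    finally show ?thesis using C(3)[of i] by (rule order_trans[rotated])
  qed
  have "AE \<omega> in M. \<omega> \<in> (\<Union>i. C i)"
    using S AE_space
  proof eventually_elim
    case (elim \<omega>)
    then obtain i where "X \<omega> \<in> U i" using U(1) by blast
    with elim C(2)[of i] show ?case by blast
  qed
  then have "1 = emeasure M (\<Union>i. C i)"
    using C(1) by (subst emeasure_eq_1_AE) auto
  also have "\<dots> \<le> (\<Sum>i. emeasure M (C i))"
    using C(1) by (intro emeasure_subadditive_countably) auto
  also have "\<dots> \<le> (\<Sum>i. ennreal k * ennreal (diameter (U i) powr s))"
    by (intro suminf_le C') auto
  also have "\<dots> = ennreal k * (\<Sum>i. ennreal (diameter (U i) powr s))"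
    by simp
  also have "\<dots> < ennreal k * ennreal (1 / k)"
    using sum k by (intro ennreal_mult_strict_left_mono) auto
  also have "\<dots> = 1"
    using k by (simp flip: ennreal_mult)
  finally show False by simp
qed

section \<open>Random points of the product set: small boxes, hyperplanes and dimension\<close>

locale digit_product =
  fixes b :: nat and A :: "'m::finite \<Rightarrow> nat \<Rightarrow> nat set"
  assumes digit_sets: "\<And>i. digit_sets b (A i)"
begin

definition P :: "('m \<Rightarrow> nat \<Rightarrow> nat) measure" where
  "P = (\<Pi>\<^sub>M i\<in>UNIV. digit_measure (A i))"

definition point :: "('m \<Rightarrow> nat \<Rightarrow> nat) \<Rightarrow> real ^ 'm" where
  "point \<omega> = (\<chi> i. expansion b (\<omega> i))"

lemma b: "b \<ge> 2"
  using digit_sets.b[OF digit_sets] .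

sublocale product_prob_space "\<lambda>i. digit_measure (A i)" UNIV
  by (rule product_prob_spaceI) (rule digit_sets.prob_digit_measure[OF digit_sets])

lemma prob_P: "prob_space P"
  unfolding P_def by (rule P.prob_space_axioms)

lemma space_P: "space P = {\<omega>. \<forall>i j. \<omega> i j \<in> A i j}"
  by (auto simp: P_def space_PiM space_digit_measure)

lemma measurable_coordinate: "(\<lambda>\<omega>. expansion b (\<omega> i)) \<in> borel_measurable P"
proof -
  have "(\<lambda>\<omega>. \<omega> i) \<in> P \<rightarrow>\<^sub>M digit_measure (A i)"
    unfolding P_def by (rule measurable_component_singleton) simp
  from measurable_compose[OF this digit_sets.measurable_expansion[OF digit_sets]] show ?thesis .
qed

lemma emeasure_box:
  fixes p :: "'m \<Rightarrow> real"
  assumes "r * real b ^ n \<le> 1"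
  defines "C \<equiv> {\<omega> \<in> space P. \<forall>i. \<bar>expansion b (\<omega> i) - p i\<bar> \<le> r}"
  shows "C \<in> sets P" "emeasure P C \<le> ennreal (\<Prod>i\<in>UNIV. 5 * (\<Prod>j<n. 1 / real (card (A i j))))"
proof -
  let ?C = "\<lambda>i. {\<omega> \<in> space (digit_measure (A i)). \<bar>expansion b \<omega> - p i\<bar> \<le> r}"
  have C: "C = Pi\<^sub>E UNIV ?C" by (auto simp: C_def P_def space_PiM)
  show "C \<in> sets P"
    unfolding C P_def by (intro sets_PiM_I_finite digit_sets.near_set_measurable[OF digit_sets]) simp
  have "emeasure P C = (\<Prod>i\<in>UNIV. emeasure (digit_measure (A i)) (?C i))"
    unfolding C P_def by (intro emeasure_PiM digit_sets.near_set_measurable[OF digit_sets]) simp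
  also have "\<dots> \<le> (\<Prod>i\<in>UNIV. ennreal (5 * (\<Prod>j<n. 1 / real (card (A i j)))))"
    by (intro prod_mono_ennreal digit_sets.emeasure_near[OF digit_sets] assms)
  also have "\<dots> = ennreal (\<Prod>i\<in>UNIV. 5 * (\<Prod>j<n. 1 / real (card (A i j))))"
    by (intro prod_ennreal mult_nonneg_nonneg prod_nonneg) auto
  finally show "emeasure P C \<le> \<dots>" .
qed

text \<open>Fubini in a coordinate with nonzero coefficient, whose distribution has no atoms.\<close>

lemma AE_not_hyperplane:
  fixes c :: "'m \<Rightarrow> real"
  assumes lim: "(\<lambda>n. \<Prod>j<n. 1 / real (card (A i0 j))) \<longlonglongrightarrow> 0" and c: "c i0 \<noteq> 0"
  shows "AE \<omega> in P. r + (\<Sum>i\<in>UNIV. c i * expansion b (\<omega> i)) \<noteq> 0"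
proof -
  define E where "E = {\<omega> \<in> space P. r + (\<Sum>i\<in>UNIV. c i * expansion b (\<omega> i)) = 0}"
  note [measurable] = measurable_coordinate
  have E [measurable]: "E \<in> sets P" unfolding E_def by measurable
  define I where "I = UNIV - {i0}"
  have I: "insert i0 I = UNIV" "i0 \<notin> I" "finite I" by (auto simp: I_def)
  \<comment> \<open>Radius 0 satisfies the scale condition of \<open>emeasure_near\<close> for every
    \<open>n\<close>, so the mass of a single value lies below a sequence tending to 0.\<close>
  have null: "emeasure (digit_measure (A i0)) {y \<in> space (digit_measure (A i0)). \<bar>expansion b y - v\<bar> \<le> 0} = 0" for v
  proof -
    have "(\<lambda>n. ennreal (5 * (\<Prod>j<n. 1 / real (card (A i0 j))))) \<longlonglongrightarrow> ennreal (5 * 0)"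
      by (intro tendsto_intros lim)
    then have "emeasure (digit_measure (A i0)) {y \<in> space (digit_measure (A i0)). \<bar>expansion b y - v\<bar> \<le> 0} \<le> ennreal (5 * 0)"
      by (rule LIMSEQ_le_const) (intro exI allI impI digit_sets.emeasure_near[OF digit_sets], simp)
    then show ?thesis by simp
  qed
  have "emeasure P E = (\<integral>\<^sup>+ \<omega>. indicator E \<omega> \<partial>P)"
    by simp
  also have "\<dots> = (\<integral>\<^sup>+ x. (\<integral>\<^sup>+ y. indicator E (x(i0 := y)) \<partial>digit_measure (A i0)) \<partial>Pi\<^sub>M I (\<lambda>i. digit_measure (A i)))"
    using product_nn_integral_insert[OF I(3,2), of "indicator E"] E
    by (simp add: I(1) P_def borel_measurable_indicator)
  also have "\<dots> = (\<integral>\<^sup>+ x. 0 \<partial>Pi\<^sub>M I (\<lambda>i. digit_measure (A i)))"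
  proof (rule nn_integral_cong)
    fix x
    \<comment> \<open>The only value of coordinate \<open>i0\<close> that puts the point on the
      hyperplane when the other coordinates are given.\<close>
    define v where "v = - (r + (\<Sum>i\<in>I. c i * expansion b (x i))) / c i0"
    let ?V = "{y \<in> space (digit_measure (A i0)). \<bar>expansion b y - v\<bar> \<le> 0}"
    have "indicator E (x(i0 := y)) \<le> (indicator ?V y :: ennreal)" if "y \<in> space (digit_measure (A i0))" for y
    proof -
      have "(\<Sum>i\<in>UNIV. c i * expansion b ((x(i0 := y)) i)) = c i0 * expansion b y + (\<Sum>i\<in>I. c i * expansion b (x i))"
      proof -
        have "(\<Sum>i\<in>I. c i * expansion b ((x(i0 := y)) i)) = (\<Sum>i\<in>I. c i * expansion b (x i))"
          using I(2) by (intro sum.cong) auto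
        then show ?thesis
          using sum.insert[OF I(3,2), of "\<lambda>i. c i * expansion b ((x(i0 := y)) i)"] by (simp add: I(1))
      qed
      moreover have "r + (\<Sum>i\<in>UNIV. c i * expansion b ((x(i0 := y)) i)) = 0" if "x(i0 := y) \<in> E"
        using that unfolding E_def by blast
      ultimately have "c i0 * expansion b y = - (r + (\<Sum>i\<in>I. c i * expansion b (x i)))" if "x(i0 := y) \<in> E"
        using that by linarith
      then have "expansion b y = v" if "x(i0 := y) \<in> E"
        using that c unfolding v_def by (metis nonzero_mult_div_cancel_left)
      then show ?thesis
        using that by (cases "x(i0 := y) \<in> E") auto
    qed
    then have "(\<integral>\<^sup>+ y. indicator E (x(i0 := y)) \<partial>digit_measure (A i0)) \<le> (\<integral>\<^sup>+ y. indicator ?V y \<partial>digit_measure (A i0))"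
      by (rule nn_integral_mono)
    also have "\<dots> = 0"
      using null[of v] digit_sets.near_set_measurable[OF digit_sets, of i0 v 0] by simp
    finally show "(\<integral>\<^sup>+ y. indicator E (x(i0 := y)) \<partial>digit_measure (A i0)) = 0" by simp
  qed
  finally have "E \<in> null_sets P" using E by (simp add: null_sets_def)
  then show ?thesis by (rule AE_I') (auto simp: E_def)
qed

text \<open>There are only countably many rational relations. One with a nonzero coefficient
  \<open>a i0\<close> cuts out a hyperplane, hence a null set; if all \<open>a i\<close> vanish, the
  relation itself says \<open>r = 0\<close>.\<close>

lemma AE_totally_irrational:
  assumes "\<And>i. (\<lambda>n. \<Prod>j<n. 1 / real (card (A i j))) \<longlonglongrightarrow> 0"
  shows "AE \<omega> in P. totally_irrational (point \<omega>)"
proof -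
  have "AE \<omega> in P. of_rat r + (\<Sum>i\<in>UNIV. of_rat (a i) * expansion b (\<omega> i)) = 0 \<longrightarrow> r = 0 \<and> (\<forall>i. a i = 0)"
    for r :: rat and a :: "'m \<Rightarrow> rat"
  proof (cases "\<forall>i. a i = 0")
    case False
    then obtain i0 where "a i0 \<noteq> 0" by blast
    then have "AE \<omega> in P. of_rat r + (\<Sum>i\<in>UNIV. of_rat (a i) * expansion b (\<omega> i)) \<noteq> 0"
      by (intro AE_not_hyperplane[OF assms, of _ i0]) simp
    then show ?thesis by eventually_elim simp
  qed simp
  then show ?thesis
    unfolding totally_irrational_def point_def by (simp add: AE_all_countable)
qed

text \<open>The decay serves twice. It excludes atoms in every coordinate, which gives total
  irrationality; and multiplied over the independent coordinates it bounds the mass of a box, so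
  that the exponents add up in the mass distribution principle.\<close>

lemma hausdorff_dim_ge:
  fixes \<tau> :: "'m \<Rightarrow> real"
  assumes \<tau>: "\<And>i. \<tau> i > 0" and H: "H \<ge> 0"
    and decay: "\<And>i n. (\<Prod>j<n. 1 / real (card (A i j))) \<le> H * real b powr (- (\<tau> i * real n))"
    and S: "\<And>\<omega>. (\<And>i j. \<omega> i j \<in> A i j) \<Longrightarrow> totally_irrational (point \<omega>) \<Longrightarrow> point \<omega> \<in> S"
  shows "ereal (\<Sum>i\<in>UNIV. \<tau> i) \<le> hausdorff_dim S"
proof -
  define \<sigma> where "\<sigma> = (\<Sum>i\<in>UNIV. \<tau> i)"
  have \<sigma>: "\<sigma> > 0" unfolding \<sigma>_def by (rule sum_pos) (auto simp: \<tau>)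
  define G where "G = (5 * H) ^ CARD('m)"
  have G: "G \<ge> 0" using H by (simp add: G_def)
  have lim: "(\<lambda>n. K * real b powr (- (u * real n))) \<longlonglongrightarrow> 0" if "u > 0" for K u
  proof -
    have "(\<lambda>n. K * (real b powr (- u)) ^ n) \<longlonglongrightarrow> K * 0"
      using b that by (intro tendsto_intros LIMSEQ_power_zero) (simp add: powr_less_one)
    then show ?thesis using b by (simp add: powr_powr flip: powr_realpow)
  qed
  have box: "(\<Prod>i\<in>UNIV. 5 * (\<Prod>j<n. 1 / real (card (A i j)))) \<le> G * real b powr (- (\<sigma> * real n))" for n
  proof -
    have "(\<Prod>i\<in>UNIV. 5 * (\<Prod>j<n. 1 / real (card (A i j)))) \<le> (\<Prod>i\<in>UNIV. 5 * H * real b powr (- (\<tau> i * real n)))"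
      using decay[of _ n] by (intro prod_mono conjI mult_nonneg_nonneg prod_nonneg) (auto simp: mult.assoc)
    also have "\<dots> = G * (\<Prod>i\<in>UNIV. real b powr (- (\<tau> i * real n)))"
      by (simp add: prod.distrib G_def power_mult_distrib)
    also have "(\<Prod>i\<in>UNIV. real b powr (- (\<tau> i * real n))) = real b powr (\<Sum>i\<in>UNIV. - (\<tau> i * real n))"
      using b by (simp add: powr_sum)
    also have "(\<Sum>i\<in>UNIV. - (\<tau> i * real n)) = - (\<sigma> * real n)"
      by (simp add: \<sigma>_def sum_negf sum_distrib_right)
    finally show ?thesis .
  qed
  have irr: "AE \<omega> in P. totally_irrational (point \<omega>)"
  proof (rule AE_totally_irrational)
    show "(\<lambda>n. \<Prod>j<n. 1 / real (card (A i j))) \<longlonglongrightarrow> 0" for i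
      by (rule tendsto_sandwich[OF _ _ tendsto_const lim[OF \<tau>[of i], of H]])
         (auto intro!: always_eventually decay prod_nonneg)
  qed
  show ?thesis
    unfolding \<sigma>_def[symmetric]
  proof (rule mass_distribution[OF prob_P])
    show "AE \<omega> in P. point \<omega> \<in> S"
      using irr AE_space by eventually_elim (rule S, auto simp: space_P)
    show "0 < (1::real)" by simp
    show "0 \<le> G * real b powr \<sigma>" using G by simp
    fix U :: "(real ^ 'm) set"
    assume U: "bounded U" "diameter U \<le> 1"
    show "\<exists>C\<in>sets P. {\<omega>\<in>space P. point \<omega> \<in> U} \<subseteq> C \<and>
        emeasure P C \<le> ennreal (G * real b powr \<sigma> * diameter U powr \<sigma>)"
    proof (cases "U = {}")
      case False
      then obtain p where p: "p \<in> U" by blast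
      define d where "d = diameter U"
      have d: "0 \<le> d" "d \<le> 1" using U by (auto simp: d_def diameter_ge_0)
      \<comment> \<open>With one point \<open>p\<close> of \<open>U\<close> fixed, all of
        \<open>U\<close> lies in the cube about \<open>p\<close> whose half side is the
        diameter.\<close>
      define C where "C = {\<omega> \<in> space P. \<forall>i. \<bar>expansion b (\<omega> i) - p $ i\<bar> \<le> d}"
      have "{\<omega>\<in>space P. point \<omega> \<in> U} \<subseteq> C"
      proof (intro subsetI)
        fix \<omega> assume "\<omega> \<in> {\<omega>\<in>space P. point \<omega> \<in> U}"
        then have \<omega>: "\<omega> \<in> space P" "point \<omega> \<in> U" by auto
        have "\<bar>expansion b (\<omega> i) - p $ i\<bar> \<le> d" for i
        proof -
          have "\<bar>(point \<omega> - p) $ i\<bar> \<le> norm (point \<omega> - p)" by (rule component_le_norm_cart)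
          also have "\<dots> \<le> d" unfolding d_def using diameter_bounded_bound[OF U(1) \<omega>(2) p] by (simp add: dist_norm)
          finally show ?thesis by (simp add: point_def)
        qed
        with \<omega> show "\<omega> \<in> C" by (simp add: C_def)
      qed
      moreover have "C \<in> sets P" using emeasure_box(1)[of d 0 "($) p"] d by (simp add: C_def)
      moreover have le: "emeasure P C \<le> ennreal (G * real b powr (- (\<sigma> * real n)))" if "d * real b ^ n \<le> 1" for n
        using emeasure_box(2)[OF that, of "($) p"] ennreal_leI[OF box[of n]] unfolding C_def
        by (rule order_trans)
      have "emeasure P C \<le> ennreal (G * real b powr \<sigma> * d powr \<sigma>)"
      proof (cases "d = 0")
        \<comment> \<open>Since \<open>0 powr \<sigma> = 0\<close>, the box has to be null here.
          Every scale \<open>n\<close> is admissible, and \<open>n\<close> tends to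
          infinity.\<close>
        case True
        have "(\<lambda>n. ennreal (G * real b powr (- (\<sigma> * real n)))) \<longlonglongrightarrow> ennreal 0"
          by (intro tendsto_ennrealI lim \<sigma>)
        then have "emeasure P C \<le> ennreal 0"
          by (rule LIMSEQ_le_const) (auto intro!: le simp: True)
        then show ?thesis by simp
      next
        case False
        with d have d0: "d > 0" by simp
        \<comment> \<open>The largest \<open>n\<close> with \<open>b ^ n <= 1 / d\<close>. Replacing
          \<open>1 / d\<close> by \<open>b ^ n\<close> loses at most one factor \<open>b\<close>,
          which accounts for \<open>b powr \<sigma>\<close> in the constant.\<close>
        define n where "n = nat \<lfloor>log (real b) (1 / d)\<rfloor>"
        have "0 \<le> log (real b) (1 / d)" using d0 d b by simp
        then have n: "real n \<le> log (real b) (1 / d)" "log (real b) (1 / d) < real n + 1"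
          unfolding n_def by linarith+
        have "real b powr real n \<le> 1 / d" "1 / d < real b powr (real n + 1)"
          using n d0 b by (auto simp: powr_le_iff less_powr_iff)
        then have n': "d * real b ^ n \<le> 1" "1 \<le> d * real b powr (real n + 1)"
          using d0 b by (auto simp: powr_realpow field_simps)
        have "real b powr (- (\<sigma> * real n)) \<le> real b powr (- (\<sigma> * real n)) * (d * real b powr (real n + 1)) powr \<sigma>"
          using mult_left_mono[OF ge_one_powr_ge_zero[OF n'(2) less_imp_le[OF \<sigma>]], of "real b powr (- (\<sigma> * real n))"]
          by simp
        also have "\<dots> = real b powr (- (\<sigma> * real n) + (real n + 1) * \<sigma>) * d powr \<sigma>"
          using d0 unfolding powr_add[of "real b" "- (\<sigma> * real n)"] by (simp add: powr_mult powr_powr)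
        also have "- (\<sigma> * real n) + (real n + 1) * \<sigma> = \<sigma>" by (simp add: algebra_simps)
        finally have "G * real b powr (- (\<sigma> * real n)) \<le> G * real b powr \<sigma> * d powr \<sigma>"
          using G by (simp add: mult_left_mono mult.assoc)
        then show ?thesis using le[OF n'(1)] ennreal_leI order_trans by blast
      qed
      ultimately show ?thesis unfolding d_def by blast
    qed auto
  qed
qed

end

section \<open>Blocks of constant digits\<close>

definition block_indices :: "(nat \<Rightarrow> nat) \<Rightarrow> (nat \<Rightarrow> nat) \<Rightarrow> nat set" where
  "block_indices n z = (\<Union>k. {n k..<z k})"

definition free_count :: "nat set \<Rightarrow> nat \<Rightarrow> nat" where
  "free_count Z m = card ({..<m} - Z)"

lemma free_count_mono: "l \<le> m \<Longrightarrow> free_count Z l \<le> free_count Z m"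
  unfolding free_count_def by (intro card_mono) auto

lemma free_count_add:
  assumes "l \<le> m" "{l..<m} \<inter> Z = {}"
  shows "free_count Z m = free_count Z l + (m - l)"
proof -
  have "{..<m} - Z = ({..<l} - Z) \<union> {l..<m}" using assms by auto
  then show ?thesis
    unfolding free_count_def using assms by (simp add: card_Un_disjoint disjoint_iff)
qed

text \<open>Positions in \<open>Z\<close> carry a single digit and contribute the factor 1.\<close>

lemma prod_inverse_card_block:
  assumes "finite V"
  shows "(\<Prod>j<m. 1 / real (card (if j \<in> Z then {e} else V))) = (1 / real (card V)) ^ free_count Z m"
proof -
  have "(\<Prod>j<m. 1 / real (card (if j \<in> Z then {e} else V))) = (\<Prod>j\<in>{..<m} - Z. 1 / real (card V))"
    by (rule prod.mono_neutral_cong_right) auto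
  then show ?thesis by (simp add: free_count_def)
qed

text \<open>The share of free digits falls along a block and recovers after it. It is at least
  \<alpha> at each block start, hence roughly \<open>\<alpha> / s\<close> or more at the block end,
  which is about \<open>s\<close> times further out. After the block the count grows with slope 1,
  which is at least \<open>\<alpha> / s\<close>.\<close>

lemma free_count_ge:
  fixes n z :: "nat \<Rightarrow> nat" and \<alpha> s :: real
  assumes nz: "\<And>k. n k \<le> z k" and zn: "\<And>k. z k \<le> n (Suc k)" and nn: "\<And>k. n k < n (Suc k)"
    and \<alpha>: "0 \<le> \<alpha>" "\<alpha> \<le> 1" and s: "1 \<le> s"
    and zs: "\<And>k. real (z k) \<le> s * real (n k) + 1"
    and gain: "\<And>k. 0 \<le> (1 - \<alpha>) * real (n (Suc k)) - real (z k) + \<alpha> * real (n k)"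
  shows "\<alpha> / s * real m - 1 \<le> real (free_count (block_indices n z) m)"
proof -
  let ?f = "free_count (block_indices n z)"
  have mono: "n k \<le> n l" "z k \<le> z l" if "k \<le> l" for k l
    using lift_Suc_mono_le[of n, OF less_imp_le[OF nn] that]
      lift_Suc_mono_le[of z, OF order_trans[OF zn nz] that] by auto
  have sm: "strict_mono n" using nn by (simp add: strict_mono_Suc_iff)
  have free: "{z k..<n (Suc k)} \<inter> block_indices n z = {}" for k
  proof -
    have False if "z k \<le> j" "j < n (Suc k)" "n l \<le> j" "j < z l" for j l
    proof (cases "l \<le> k")
      case True
      then show False using mono(2)[of l k] that by simp
    next
      case False
      then show False using mono(1)[of "Suc k" l] that by simp
    qed
    then show ?thesis unfolding block_indices_def by auto
  qed
  have init: "{0..<n 0} \<inter> block_indices n z = {}"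
  proof -
    have "n 0 \<le> n k" for k using mono(1) by simp
    then have "n 0 \<le> j" if "n k \<le> j" for j k using that order_trans by blast
    then show ?thesis unfolding block_indices_def by (auto simp: not_le[symmetric])
  qed
  have init': "?f m = m" if "m \<le> n 0" for m
  proof -
    have "{0..<m} \<inter> block_indices n z = {}" using init that by (meson disjoint_iff atLeastLessThan_iff less_le_trans)
    from free_count_add[OF _ this] show ?thesis by (simp add: free_count_def)
  qed
  have step: "?f m = ?f (z k) + (m - z k)" if "z k \<le> m" "m \<le> n (Suc k)" for m k
  proof (rule free_count_add[OF that(1)])
    show "{z k..<m} \<inter> block_indices n z = {}"
      using free[of k] that(2) by (meson disjoint_iff atLeastLessThan_iff less_le_trans)
  qed
  \<comment> \<open>Rearranged, \<open>gain\<close> says that the free stretch from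
    \<open>z k\<close> to \<open>n (Suc k)\<close> makes up at least the share \<alpha> of the
    stretch from \<open>n k\<close> to \<open>n (Suc k)\<close>.\<close>
  have start: "\<alpha> * real (n k) \<le> real (?f (n k))" for k
  proof (induction k)
    case 0
    show ?case using \<alpha> by (simp add: init' mult_left_le_one_le)
  next
    case (Suc k)
    have "real (?f (n (Suc k))) = real (?f (z k)) + (real (n (Suc k)) - real (z k))"
      using step[of k "n (Suc k)"] zn[of k] by simp
    moreover have "real (?f (n k)) \<le> real (?f (z k))"
      using free_count_mono[OF nz] by simp
    ultimately show ?case using Suc gain[of k] by (simp add: algebra_simps)
  qed
  have \<alpha>s: "0 \<le> \<alpha> / s" "\<alpha> / s \<le> 1" using \<alpha> s by (auto simp: divide_le_eq)
  \<comment> \<open>Inside a block the count is bounded by its value at \<open>n k\<close>. Rounding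
    in \<open>z k\<close> allows \<open>m\<close> to exceed \<open>s * n k\<close> by 1, which costs
    \<open>\<alpha> / s <= 1\<close>; this is the \<open>- 1\<close> of the conclusion.\<close>
  have mid: "\<alpha> / s * real m - 1 \<le> real (?f m)" if "n k \<le> m" "m \<le> z k" for m k
  proof -
    have "\<alpha> / s * real m \<le> \<alpha> / s * (s * real (n k) + 1)"
      using zs[of k] that \<alpha>s by (intro mult_left_mono) auto
    also have "\<dots> = \<alpha> * real (n k) + \<alpha> / s" using s by (simp add: field_simps)
    also have "\<dots> \<le> real (?f m) + 1"
      using start[of k] free_count_mono[OF that(1), of "block_indices n z"] \<alpha>s by simp
    finally show ?thesis by simp
  qed
  show ?thesis
  proof (cases "m \<le> n 0")
    case True
    then show ?thesis using init' \<alpha>s mult_left_le_one_le[of "real m" "\<alpha> / s"] by simp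
  next
    case False
    have "m \<le> n m" using sm by (rule strict_mono_imp_increasing)
    then have ex: "\<exists>k. m \<le> n k" by blast
    \<comment> \<open>The first block start at or beyond \<open>m\<close>; with its predecessor
      \<open>l\<close>, the index \<open>m\<close> lies in the block of \<open>l\<close> or in the
      free stretch after it.\<close>
    define k where "k = (LEAST k. m \<le> n k)"
    have mk: "m \<le> n k" unfolding k_def by (rule LeastI_ex[OF ex])
    have "k \<noteq> 0" using False mk by metis
    then obtain l where l: "k = Suc l" by (cases k) auto
    have "\<not> m \<le> n l" using not_less_Least[of l "\<lambda>k. m \<le> n k"] l k_def by simp
    show ?thesis
    proof (cases "m \<le> z l")
      case True
      then show ?thesis using mid[of l m] \<open>\<not> m \<le> n l\<close> by simp
    next
      case False
      then have "real (?f m) = real (?f (z l)) + (real m - real (z l))"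
        using step[of l m] mk l by simp
      moreover have "\<alpha> / s * real (z l) - 1 \<le> real (?f (z l))" using mid[of l "z l"] nz by simp
      moreover have "\<alpha> / s * (real m - real (z l)) \<le> real m - real (z l)"
        using False \<alpha>s by (intro mult_left_le_one_le) auto
      ultimately show ?thesis by (simp add: algebra_simps)
    qed
  qed
qed

section \<open>Block sequences of geometric growth\<close>

lemma block_sequences_exist:
  fixes T s \<alpha> w :: real
  assumes s: "1 \<le> s" and sT: "s < T" and \<alpha>: "0 \<le> \<alpha>" "\<alpha> < (T - s) / (T - 1)"
    and w: "0 \<le> w" "1 + w * T < s"
  obtains n z :: "nat \<Rightarrow> nat" where "\<And>k. n k \<le> z k" "\<And>k. z k \<le> n (Suc k)" "\<And>k. n k < n (Suc k)"
    "\<And>k. real (z k) \<le> s * real (n k) + 1"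
    "\<And>k. 0 \<le> (1 - \<alpha>) * real (n (Suc k)) - real (z k) + \<alpha> * real (n k)"
    "LIM k sequentially. real (z k) - real (n k) - w * real (n (Suc k)) :> at_top"
proof -
  have T: "1 < T" using s sT by simp
  \<comment> \<open>Without rounding, \<open>n k = B * T ^ k\<close> and
    \<open>z k = s * n k\<close> turn the expression in the gain condition into
    \<open>\<gamma> * B * T ^ k\<close>, so \<gamma> measures the available slack.\<close>
  define \<gamma> where "\<gamma> = T - s - \<alpha> * (T - 1)"
  have \<gamma>: "0 < \<gamma>" using \<alpha>(2) T by (simp add: \<gamma>_def field_simps)
  have \<gamma>_le: "\<gamma> \<le> T - s" using \<alpha>(1) T by (simp add: \<gamma>_def)
  have "(T - s) / (T - 1) \<le> 1" using s sT by (simp add: field_simps)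
  then have \<alpha>1: "\<alpha> < 1" using \<alpha>(2) by simp
  \<comment> \<open>Rounding both sequences up raises \<open>z k\<close> by at most
    \<open>s + 1\<close>. This \<open>B\<close> makes the slack at least as large from
    \<open>k = 0\<close> on; as \<open>\<gamma> <= T - s\<close>, it also keeps each block before
    the next one.\<close>
  define B where "B = (s + 1) / \<gamma>"
  have B: "B > 0" "B * \<gamma> = s + 1" using s \<gamma> by (auto simp: B_def)
  define n where "n k = nat \<lceil>B * T ^ k\<rceil>" for k
  define z where "z k = nat \<lceil>s * real (n k)\<rceil>" for k
  have n: "B * T ^ k \<le> real (n k)" "real (n k) < B * T ^ k + 1" for k
  proof -
    have "0 < B * T ^ k" using B T by simp
    then show "B * T ^ k \<le> real (n k)" "real (n k) < B * T ^ k + 1" unfolding n_def by linarith+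
  qed
  have z: "s * real (n k) \<le> real (z k)" "real (z k) < s * real (n k) + 1" for k
  proof -
    have "0 \<le> s * real (n k)" using s by simp
    then show "s * real (n k) \<le> real (z k)" "real (z k) < s * real (n k) + 1" unfolding z_def by linarith+
  qed
  have Tk: "1 \<le> T ^ k" for k using T by (simp add: one_le_power)
  have zb: "real (z k) \<le> s * B * T ^ k + s + 1" for k
    using z(2)[of k] mult_left_mono[OF less_imp_le[OF n(2)[of k]], of s] s by (simp add: algebra_simps)
  have gap: "s + 1 \<le> B * \<gamma> * T ^ k" for k using B Tk[of k] s by simp
  have zn: "real (z k) \<le> real (n (Suc k))" for k
  proof -
    have "B * \<gamma> * T ^ k \<le> B * (T - s) * T ^ k"
      using \<gamma>_le B T by (intro mult_right_mono mult_left_mono) auto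
    then show ?thesis using zb[of k] gap[of k] n(1)[of "Suc k"] by (simp add: algebra_simps)
  qed
  have nz: "real (n k) \<le> real (z k)" for k
    using z(1)[of k] mult_right_mono[OF s, of "real (n k)"] by simp
  have n0: "0 < n k" for k
  proof -
    have "0 < B * T ^ k" using B T by simp
    then show ?thesis using n(1)[of k] by linarith
  qed
  have "0 \<le> w * T" using w T by simp
  then have s1: "1 < s" using w by linarith
  have nn: "real (n k) < real (n (Suc k))" for k
  proof -
    have "real (n k) < s * real (n k)" using s1 n0[of k] by simp
    then show ?thesis using z(1)[of k] zn[of k] by simp
  qed
  have gain: "0 \<le> (1 - \<alpha>) * real (n (Suc k)) - real (z k) + \<alpha> * real (n k)" for k
  proof -
    have "(1 - \<alpha>) * (B * T ^ Suc k) \<le> (1 - \<alpha>) * real (n (Suc k))"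
      using n(1)[of "Suc k"] \<alpha>1 by (intro mult_left_mono) auto
    moreover have "\<alpha> * (B * T ^ k) \<le> \<alpha> * real (n k)"
      using n(1)[of k] \<alpha> by (intro mult_left_mono) auto
    ultimately show ?thesis
      using zb[of k] gap[of k] unfolding \<gamma>_def by (simp add: algebra_simps)
  qed
  \<comment> \<open>Up to the constant \<open>w\<close>, the expression is at least
    \<open>B * (s - 1 - w * T) * T ^ k\<close>, and the strict inequality
    \<open>1 + w * T < s\<close> makes this coefficient positive.\<close>
  have lim: "LIM k sequentially. real (z k) - real (n k) - w * real (n (Suc k)) :> at_top"
  proof (rule filterlim_at_top_mono)
    have "0 < B * (s - 1 - w * T)" using B w by simp
    moreover have "LIM k sequentially. T ^ k :> at_top"
      using T by (intro filterlim_at_infinity_imp_filterlim_at_top filterlim_realpow_sequentially_gt1) auto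
    ultimately have "LIM k sequentially. - w + B * (s - 1 - w * T) * T ^ k :> at_top"
      by (intro filterlim_tendsto_add_at_top[OF tendsto_const]
          filterlim_tendsto_pos_mult_at_top[OF tendsto_const]) auto
    then show "LIM k sequentially. - w + B * (s - 1 - w * T) * T ^ k :> at_top" .
    have "- w + B * (s - 1 - w * T) * T ^ k \<le> real (z k) - real (n k) - w * real (n (Suc k))" for k
    proof -
      have "w * real (n (Suc k)) \<le> w * (B * T ^ Suc k + 1)"
        using n(2)[of "Suc k"] w by (intro mult_left_mono) auto
      moreover have "(s - 1) * (B * T ^ k) \<le> (s - 1) * real (n k)"
        using n(1)[of k] s by (intro mult_left_mono) auto
      ultimately show ?thesis using z(1)[of k] by (simp add: algebra_simps)
    qed
    then show "\<forall>\<^sub>F k in sequentially. - w + B * (s - 1 - w * T) * T ^ k \<le> real (z k) - real (n k) - w * real (n (Suc k))"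
      by simp
  qed
  show ?thesis
  proof (rule that[of n z])
    show "n k \<le> z k" "z k \<le> n (Suc k)" "n k < n (Suc k)" for k
      using nz[of k] zn[of k] nn[of k] by auto
    show "real (z k) \<le> s * real (n k) + 1" for k using z(2)[of k] by simp
  qed (use gain lim in auto)
qed

section \<open>Points with constant blocks are singular, for any norm\<close>

lemma is_norm_le_components:
  fixes N :: "real ^ 'm::finite \<Rightarrow> real"
  assumes N: "is_norm N" and x: "\<And>i. \<bar>x $ i\<bar> \<le> r"
  shows "N x \<le> r * (\<Sum>i\<in>UNIV. N (axis i 1))"
proof -
  have sub: "N (\<Sum>i\<in>I. f i) \<le> (\<Sum>i\<in>I. N (f i))" if "finite I" for I :: "'m set" and f
    using that
  proof (induction I rule: finite_induct)
    case empty
    have "N 0 = 0" using N unfolding is_norm_def by blast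
    then show ?case by simp
  next
    case (insert i I)
    have "N (f i + sum f I) \<le> N (f i) + N (sum f I)" using N by (simp add: is_norm_def)
    with insert show ?case by simp
  qed
  have "x = (\<Sum>i\<in>UNIV. x $ i *\<^sub>R axis i 1)"
    using basis_expansion[of x] by (simp add: scalar_mult_eq_scaleR)
  then have "N x \<le> (\<Sum>i\<in>UNIV. N (x $ i *\<^sub>R axis i 1))"
    using sub[of UNIV "\<lambda>i. x $ i *\<^sub>R axis i 1"] by simp
  also have "\<dots> = (\<Sum>i\<in>UNIV. \<bar>x $ i\<bar> * N (axis i 1))"
    using N by (simp add: is_norm_def)
  also have "\<dots> \<le> (\<Sum>i\<in>UNIV. r * N (axis i 1))"
    using N x by (intro sum_mono mult_right_mono) (auto simp: is_norm_def)
  finally show ?thesis by (simp add: sum_distrib_left)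
qed

text \<open>For \<open>g * b ^ n k <= Q < g * b ^ n (Suc k)\<close> the same denominator
  \<open>g * b ^ n k\<close> serves. Its error is of order \<open>b powr (n k - z k)\<close>, the
  requirement is strictest at the right end of the range, and \<open>lim\<close> makes the quotient
  of the two tend to 0.\<close>

lemma block_expansion_singular:
  fixes N :: "real ^ 'm::finite \<Rightarrow> real" and \<omega> :: "'m \<Rightarrow> nat \<Rightarrow> nat"
  assumes b: "b \<ge> 2" and N: "is_norm N" and w: "0 \<le> w"
    and g: "g > 0" "\<And>k. int g * int b ^ k \<in> D" "\<And>i. (b - 1) dvd g * e i"
    and \<omega>: "\<And>i j. \<omega> i j < b" and e: "\<And>i. e i < b"
    and block: "\<And>i j k. n k \<le> j \<Longrightarrow> j < z k \<Longrightarrow> \<omega> i j = e i"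
    and nz: "\<And>k. n k \<le> z k" and nn: "\<And>k. n k < n (Suc k)"
    and lim: "LIM k sequentially. real (z k) - real (n k) - w * real (n (Suc k)) :> at_top"
    and irr: "totally_irrational (\<chi> i. expansion b (\<omega> i))"
  shows "(\<chi> i. expansion b (\<omega> i)) \<in> singular_with D N w"
  unfolding singular_with_def
proof (intro CollectI conjI allI impI irr)
  fix c :: real assume c: "c > 0"
  define \<xi> where "\<xi> = (\<chi> i. expansion b (\<omega> i))"
  \<comment> \<open>The added 1 makes \<Gamma> positive, and with it the argument of the logarithm
    in \<open>L\<close>.\<close>
  define \<Gamma> where "\<Gamma> = (\<Sum>i\<in>(UNIV::'m set). N (axis i 1)) + 1"
  have "0 \<le> (\<Sum>i\<in>(UNIV::'m set). N (axis i 1))"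
    using N by (intro sum_nonneg) (auto simp: is_norm_def)
  then have \<Gamma>: "\<Gamma> > 0" by (simp add: \<Gamma>_def)
  \<comment> \<open>The inequality \<open>g * b powr (n k - z k) * \<Gamma> <= c * (g * b ^ n (Suc
    k)) powr (- w)\<close>, solved for the exponent \<open>z k - n k - w * n (Suc k)\<close>, reads:
    exponent at least \<open>L\<close>.\<close>
  define L where "L = log (real b) (g powr (1 + w) * \<Gamma> / c)"
  obtain K where K: "\<And>k. k \<ge> K \<Longrightarrow> L \<le> real (z k) - real (n k) - w * real (n (Suc k))"
    using lim unfolding filterlim_at_top eventually_sequentially by blast
  have sm: "strict_mono n" using nn by (simp add: strict_mono_Suc_iff)
  have "\<exists>q\<in>D. \<exists>p :: int ^ 'm. 1 \<le> q \<and> of_int q \<le> Q \<and>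
      N (of_int q *\<^sub>R \<xi> - (\<chi> i. of_int (p $ i))) \<le> c * Q powr (- w)"
    if Q: "real g * real b ^ n K \<le> Q" for Q
  proof -
    have gb: "0 < real g * real b ^ j" for j using g b by simp
    have "\<exists>k. Q < real g * real b ^ n k"
    proof -
      obtain j where "Q / real g < real b ^ j" using real_arch_pow[of "real b"] b by auto
      also have "real b ^ j \<le> real b ^ n j"
        using b strict_mono_imp_increasing[OF sm, of j] by (intro power_increasing) auto
      finally show ?thesis using g by (auto simp: field_simps)
    qed
    \<comment> \<open>The first block start beyond \<open>Q\<close>; its predecessor
      \<open>k\<close> bounds \<open>Q\<close> from below and is at least \<open>K\<close>.\<close>
    then obtain k' where k': "Q < real g * real b ^ n k'" "\<And>l. l < k' \<Longrightarrow> \<not> Q < real g * real b ^ n l"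
      using exists_least_iff[of "\<lambda>k. Q < real g * real b ^ n k"] by blast
    have "K < k'"
    proof (rule ccontr)
      assume "\<not> K < k'"
      then have "real b ^ n k' \<le> real b ^ n K"
        using b sm by (intro power_increasing) (auto simp: strict_mono_less_eq)
      then have "real g * real b ^ n k' \<le> real g * real b ^ n K" by (intro mult_left_mono) auto
      then show False using k'(1) Q by linarith
    qed
    then obtain k where k: "k' = Suc k" "K \<le> k" by (cases k') auto
    have Qk: "real g * real b ^ n k \<le> Q" "Q < real g * real b ^ n (Suc k)"
      using k' k by (auto simp: not_less)
    have "\<exists>p. \<forall>i. \<bar>real g * real b ^ n k * expansion b (\<omega> i) - of_int (p i)\<bar>
        \<le> real g * real b powr (real (n k) - real (z k))"
    proof (intro choice allI)
      fix i
      show "\<exists>p. \<bar>real g * real b ^ n k * expansion b (\<omega> i) - of_int p\<bar>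
          \<le> real g * real b powr (real (n k) - real (z k))"
        by (rule expansion_block_approx[where a = "\<omega> i" and e = "e i", OF b \<omega> e g(3) block nz])
    qed
    then obtain p :: "'m \<Rightarrow> int" where
      p: "\<And>i. \<bar>real g * real b ^ n k * expansion b (\<omega> i) - of_int (p i)\<bar>
        \<le> real g * real b powr (real (n k) - real (z k))" by blast
    define q where "q = int g * int b ^ n k"
    have q: "of_int q = real g * real b ^ n k" by (simp add: q_def)
    have "N (of_int q *\<^sub>R \<xi> - (\<chi> i. of_int ((\<chi> i. p i) $ i)))
        \<le> real g * real b powr (real (n k) - real (z k)) * (\<Sum>i\<in>(UNIV::'m set). N (axis i 1))"
      unfolding q by (rule is_norm_le_components[OF N]) (use p in \<open>simp add: \<xi>_def\<close>)
    also have "\<dots> \<le> real g * real b powr (real (n k) - real (z k)) * \<Gamma>"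
      unfolding \<Gamma>_def by (intro mult_left_mono) auto
    also have "\<dots> \<le> c * (real g * real b ^ n (Suc k)) powr (- w)"
    proof -
      have pos: "0 < g powr (1 + w) * \<Gamma> / c" using g \<Gamma> c by simp
      have "real b powr L \<le> real b powr (real (z k) - real (n k) - w * real (n (Suc k)))"
        using K[OF k(2)] b by (intro powr_mono) auto
      then have "g powr (1 + w) * \<Gamma> / c \<le> real b powr (real (z k) - real (n k) - w * real (n (Suc k)))"
        using pos b unfolding L_def by (simp del: powr_log_cancel add: powr_log_cancel[of "real b"])
      then have "g powr (1 + w) * \<Gamma> \<le> c * real b powr (real (z k) - real (n k) - w * real (n (Suc k)))"
        using c by (simp add: field_simps)
      then have "g powr (1 + w) * \<Gamma> * (g powr (- w) * real b powr (real (n k) - real (z k)))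
        \<le> c * real b powr (real (z k) - real (n k) - w * real (n (Suc k))) * (g powr (- w) * real b powr (real (n k) - real (z k)))"
        by (rule mult_right_mono) simp
      moreover have "g powr (1 + w) * \<Gamma> * (g powr (- w) * real b powr (real (n k) - real (z k)))
          = (g powr (1 + w) * g powr (- w)) * real b powr (real (n k) - real (z k)) * \<Gamma>"
        by simp
      moreover have "g powr (1 + w) * g powr (- w) = real g"
        using g by (simp flip: powr_add)
      moreover have "c * real b powr (real (z k) - real (n k) - w * real (n (Suc k))) * (g powr (- w) * real b powr (real (n k) - real (z k)))
          = c * (g powr (- w) * (real b powr (real (z k) - real (n k) - w * real (n (Suc k))) * real b powr (real (n k) - real (z k))))"
        by simp
      moreover have "real b powr (real (z k) - real (n k) - w * real (n (Suc k))) * real b powr (real (n k) - real (z k))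
          = real b powr (- w * real (n (Suc k)))"
        by (simp flip: powr_add)
      moreover have "(real g * real b ^ n (Suc k)) powr (- w) = g powr (- w) * real b powr (- w * real (n (Suc k)))"
        using b g by (simp add: powr_mult powr_powr mult.commute flip: powr_realpow)
      ultimately show ?thesis by simp
    qed
    also have "\<dots> \<le> c * Q powr (- w)"
    proof -
      have "0 < Q" using Qk(1) gb[of "n k"] by linarith
      then have "(real g * real b ^ n (Suc k)) powr (- w) \<le> Q powr (- w)"
        using w Qk(2) by (intro powr_mono2') auto
      then show ?thesis using c by simp
    qed
    finally have "N (of_int q *\<^sub>R \<xi> - (\<chi> i. of_int ((\<chi> i. p i) $ i))) \<le> c * Q powr (- w)" .
    moreover have "q \<in> D" unfolding q_def by (rule g(2))
    moreover have "1 \<le> q" using g b by (simp add: q_def int_one_le_iff_zero_less)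
    moreover have "of_int q \<le> Q" using Qk(1) q by simp
    ultimately show ?thesis by blast
  qed
  then show "\<forall>\<^sub>F Q :: real in at_top. \<exists>q\<in>D. \<exists>p :: int ^ 'm. 1 \<le> q \<and> of_int q \<le> Q \<and>
      N (of_int q *\<^sub>R (\<chi> i. expansion b (\<omega> i)) - (\<chi> i. of_int (p $ i))) \<le> c * Q powr (- w)"
    unfolding \<xi>_def[symmetric] by (rule eventually_at_top_linorderI)
qed

section \<open>The dimension bound\<close>

lemma singular_with_mono:
  fixes N :: "real ^ 'm::finite \<Rightarrow> real"
  assumes "D \<subseteq> D'" shows "singular_with D N w \<subseteq> singular_with D' N w"
  unfolding singular_with_def
proof (intro Collect_mono impI conjI allI)
  fix \<xi> :: "real ^ 'm" and c :: real
  let ?P = "\<lambda>D c Q. \<exists>q\<in>D. \<exists>p :: int ^ 'm. 1 \<le> q \<and> of_int q \<le> Q \<and>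
    N (of_int q *\<^sub>R \<xi> - (\<chi> i. of_int (p $ i))) \<le> c * Q powr (- w)"
  assume *: "totally_irrational \<xi> \<and> (\<forall>c>0. \<forall>\<^sub>F Q in at_top. ?P D c Q)"
  then show "totally_irrational \<xi>" by blast
  assume "0 < c"
  with * have "\<forall>\<^sub>F Q in at_top. ?P D c Q" by blast
  then show "\<forall>\<^sub>F Q in at_top. ?P D' c Q"
    by (rule eventually_mono) (use assms in blast)
qed

lemma digit_dim_bounds:
  assumes "b \<ge> 2" "W \<subseteq> {0..<b}" "card W \<ge> 2"
  shows "0 < digit_dim b W" "digit_dim b W \<le> 1" "real b powr digit_dim b W = real (card W)"
proof -
  have "card W \<le> b" using card_mono[OF _ assms(2)] by simp
  moreover have "0 < ln (real b)" "0 < ln (real (card W))" using assms by auto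
  ultimately show "0 < digit_dim b W" "digit_dim b W \<le> 1"
    using assms by (auto simp: digit_dim_def divide_le_eq)
  show "real b powr digit_dim b W = real (card W)"
    using assms by (simp add: digit_dim_def powr_def)
qed

text \<open>Keeping \<open>e\<close>, \<open>g\<close> and \<open>D\<close> as parameters covers two
  uses: zero blocks with \<open>g = 1\<close>, where the denominators are powers of
  \<open>b\<close>, and blocks of arbitrary digits with \<open>g = b - 1\<close>.\<close>

lemma hausdorff_dim_singular_ge:
  fixes N :: "real ^ 'm::finite \<Rightarrow> real" and W :: "'m \<Rightarrow> nat set"
  assumes b: "b \<ge> 2" and W: "\<And>i. W i \<subseteq> {0..<b}" "\<And>i. card (W i) \<ge> 2" and N: "is_norm N"
    and e: "\<And>i. e i \<in> W i" and g: "g > 0" "\<And>k. int g * int b ^ k \<in> D" "\<And>i. (b - 1) dvd g * e i"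
    and s: "1 \<le> s" "s < T" and \<alpha>: "0 < \<alpha>" "\<alpha> < (T - s) / (T - 1)" and w: "0 \<le> w" "1 + w * T < s"
  shows "ereal ((\<Sum>i\<in>UNIV. digit_dim b (W i)) * (\<alpha> / s))
    \<le> hausdorff_dim (singular_with D N w \<inter> missing_digit_product b W)"
proof -
  obtain n z :: "nat \<Rightarrow> nat" where nz: "\<And>k. n k \<le> z k" "\<And>k. z k \<le> n (Suc k)" "\<And>k. n k < n (Suc k)"
    "\<And>k. real (z k) \<le> s * real (n k) + 1"
    "\<And>k. 0 \<le> (1 - \<alpha>) * real (n (Suc k)) - real (z k) + \<alpha> * real (n k)"
    "LIM k sequentially. real (z k) - real (n k) - w * real (n (Suc k)) :> at_top"
    using block_sequences_exist[OF s less_imp_le[OF \<alpha>(1)] \<alpha>(2) w] by blast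
  define Z where "Z = block_indices n z"
  define A where "A i j = (if j \<in> Z then {e i} else W i)" for i :: 'm and j :: nat
  define d where "d i = digit_dim b (W i)" for i
  note d = digit_dim_bounds[OF b W, folded d_def]
  have A_W: "A i j \<subseteq> W i" for i j using e by (simp add: A_def)
  have A_b: "A i j \<subseteq> {0..<b}" for i j using A_W W(1) by (rule order_trans)
  interpret digit_product b A
  proof (intro digit_product.intro digit_sets.intro b A_b)
    show "A i j \<noteq> {}" for i j using W(2)[of i] by (auto simp: A_def)
  qed
  have "(T - s) / (T - 1) \<le> 1" using s by (simp add: field_simps)
  then have \<alpha>1: "\<alpha> \<le> 1" using \<alpha>(2) by simp
  have decay: "(\<Prod>j<m. 1 / real (card (A i j))) \<le> real b * real b powr (- (d i * (\<alpha> / s) * real m))" for i m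
  proof -
    have "(\<Prod>j<m. 1 / real (card (A i j))) = (1 / real (card (W i))) ^ free_count Z m"
      unfolding A_def by (rule prod_inverse_card_block) (rule finite_subset[OF W(1)], simp)
    also have "1 / real (card (W i)) = real b powr (- d i)"
      by (simp add: powr_minus d(3) divide_inverse)
    also have "(real b powr (- d i)) ^ free_count Z m = real b powr (- (d i * real (free_count Z m)))"
      using b by (simp add: powr_powr flip: powr_realpow)
    \<comment> \<open>One free digit is worth a factor \<open>card (W i) <= b\<close>, so the
      \<open>- 1\<close> in the count turns into the constant \<open>b\<close>.\<close>
    also have "\<dots> \<le> real b powr (1 - d i * (\<alpha> / s) * real m)"
    proof (rule powr_mono)
      have "\<alpha> / s * real m - 1 \<le> real (free_count Z m)"
        unfolding Z_def by (rule free_count_ge[where n = n and z = z, OF nz(1-3) less_imp_le[OF \<alpha>(1)] \<alpha>1 s(1) nz(4,5)])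
      then have "d i * (\<alpha> / s * real m - 1) \<le> d i * real (free_count Z m)"
        using d(1)[of i] by (intro mult_left_mono) auto
      then show "- (d i * real (free_count Z m)) \<le> 1 - d i * (\<alpha> / s) * real m"
        using d(2)[of i] by (simp add: right_diff_distrib mult.assoc)
    qed (use b in simp)
    also have "\<dots> = real b * real b powr (- (d i * (\<alpha> / s) * real m))"
      using b unfolding diff_conv_add_uminus powr_add by simp
    finally show ?thesis .
  qed
  have "ereal (\<Sum>i\<in>UNIV. d i * (\<alpha> / s)) \<le> hausdorff_dim (singular_with D N w \<inter> missing_digit_product b W)"
  proof (rule hausdorff_dim_ge[OF _ _ decay])
    show "0 < d i * (\<alpha> / s)" for i using d(1) \<alpha> s by simp
    fix \<omega> assume \<omega>: "\<And>i j. \<omega> i j \<in> A i j" and irr: "totally_irrational (point \<omega>)"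
    have "\<omega> i j < b" for i j using \<omega>[of i j] A_b[of i j] by auto
    moreover have "e i < b" for i using e[of i] W(1)[of i] by auto
    moreover have "\<omega> i j = e i" if "n k \<le> j" "j < z k" for i j k
      using \<omega>[of i j] that by (auto simp: A_def Z_def block_indices_def split: if_splits)
    ultimately have "point \<omega> \<in> singular_with D N w"
      unfolding point_def
      by (intro block_expansion_singular[where e = e and g = g and n = n and z = z])
         (use b N w g nz irr in \<open>auto simp: point_def\<close>)
    moreover have "\<omega> i j \<in> W i" for i j using \<omega> A_W by blast
    then have "point \<omega> \<in> missing_digit_product b W"
      using b W unfolding missing_digit_product_def point_def
      by (auto intro!: expansion_mem_missing_digit_set)
    ultimately show "point \<omega> \<in> singular_with D N w \<inter> missing_digit_product b W" by blast
  qed simp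
  then show ?thesis unfolding d_def sum_distrib_right .
qed

text \<open>The strict inequalities on the parameters are removed by continuity: for fixed
  \<open>T\<close>, let \<open>s\<close> decrease to its critical value and \<alpha> increase to
  \<open>(T - s) / (T - 1)\<close>.\<close>

lemma hausdorff_dim_singular_ge_limit:
  fixes N :: "real ^ 'm::finite \<Rightarrow> real" and W :: "'m \<Rightarrow> nat set"
  assumes b: "b \<ge> 2" and W: "\<And>i. W i \<subseteq> {0..<b}" "\<And>i. card (W i) \<ge> 2" and N: "is_norm N"
    and e: "\<And>i. e i \<in> W i" and g: "g > 0" "\<And>k. int g * int b ^ k \<in> D" "\<And>i. (b - 1) dvd g * e i"
    and t: "1 < t" and w: "0 \<le> w" "w * t < 1"
  shows "ereal ((\<Sum>i\<in>UNIV. digit_dim b (W i)) * ((t - 1) * (1 - w * t) / ((w + 1) * t - 1)))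
    \<le> hausdorff_dim (singular_with D N w \<inter> missing_digit_product b W)" (is "ereal ?G \<le> ?dim")
proof (rule ccontr)
  assume "\<not> ereal ?G \<le> ?dim"
  then obtain v where v: "?dim = ereal v" "v < ?G" "0 \<le> v"
    using hausdorff_dim_nonneg[of "singular_with D N w \<inter> missing_digit_product b W"] by (cases ?dim) auto
  define d where "d = (\<Sum>i\<in>UNIV. digit_dim b (W i))"
  have d: "d > 0" unfolding d_def using digit_dim_bounds(1)[OF b W] by (intro sum_pos) auto
  \<comment> \<open>This solves \<open>s0 = 1 + w * T\<close> together with
    \<open>T = t * s0\<close>; thus \<open>t\<close> is the limiting ratio of the next block start
    to a block end.\<close>
  define s0 where "s0 = 1 / (1 - w * t)"
  define T where "T = t * s0"
  have wt: "0 \<le> w * t" "0 < 1 - w * t" using t w by auto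
  then have wt1: "0 < (w + 1) * t - 1" using t unfolding distrib_right by linarith
  have s0_inv: "s0 * (1 - w * t) = 1" using wt by (simp add: s0_def)
  have "1 \<le> s0" using wt by (simp add: s0_def le_divide_eq)
  moreover have "s0 < T" using t \<open>1 \<le> s0\<close> by (simp add: T_def)
  moreover have "1 + w * T = s0" using s0_inv unfolding T_def by (simp add: algebra_simps)
  ultimately have s0: "1 \<le> s0" "s0 < T" "1 + w * T = s0" by auto
  have T: "1 < T" using s0 by simp
  have "T - s0 = (t - 1) * s0" by (simp add: T_def algebra_simps)
  moreover have "T - 1 = ((w + 1) * t - 1) * s0"
  proof -
    have "T - 1 = T - s0 * (1 - w * t)" by (simp add: s0_inv)
    then show ?thesis by (simp add: T_def algebra_simps)
  qed
  ultimately have "(T - s0) / ((T - 1) * s0) = (t - 1) / (((w + 1) * t - 1) * s0)"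
    using s0 by simp
  also have "\<dots> = (t - 1) * (1 - w * t) / ((w + 1) * t - 1)"
    by (simp add: s0_def)
  finally have G: "?G = d * ((T - s0) / ((T - 1) * s0))"
    by (simp add: d_def)
  have "isCont (\<lambda>s. d * ((T - s) / ((T - 1) * s))) s0"
    using s0 T by (intro continuous_intros) auto
  then have "((\<lambda>s. d * ((T - s) / ((T - 1) * s))) \<longlongrightarrow> ?G) (at_right s0)"
    unfolding G isCont_def by (rule tendsto_mono[OF at_le, rotated]) simp
  then have "\<forall>\<^sub>F s in at_right s0. v < d * ((T - s) / ((T - 1) * s))"
    using v(2) by (rule order_tendstoD)
  moreover have "\<forall>\<^sub>F s in at_right s0. s0 < s \<and> s < T"
    using eventually_at_right_field s0(2) by auto
  ultimately have "\<forall>\<^sub>F s in at_right s0. v < d * ((T - s) / ((T - 1) * s)) \<and> s0 < s \<and> s < T"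
    by (rule eventually_conj)
  from eventually_happens'[OF trivial_limit_at_right_real this]
  obtain s where s: "v < d * ((T - s) / ((T - 1) * s))" "s0 < s" "s < T" by blast
  \<comment> \<open>Rearranged so that any \<alpha> strictly in between still gives
    \<open>v < d * (\<alpha> / s)\<close>.\<close>
  have "v * s / d < (T - s) / (T - 1)"
  proof -
    have "v * s / d < d * ((T - s) / ((T - 1) * s)) * s / d"
      using s(1,2) s0 d by (intro divide_strict_right_mono mult_strict_right_mono) auto
    also have "\<dots> = (T - s) / (T - 1)" using d s s0 by simp
    finally show ?thesis .
  qed
  then obtain \<alpha> where \<alpha>: "v * s / d < \<alpha>" "\<alpha> < (T - s) / (T - 1)"
    using dense by blast
  have "0 \<le> v * s / d" using v d s s0 by simp
  then have "0 < \<alpha>" using \<alpha> by linarith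
  have "ereal (d * (\<alpha> / s)) \<le> ?dim"
    unfolding d_def using s s0 \<alpha> \<open>0 < \<alpha>\<close> w
    by (intro hausdorff_dim_singular_ge[where e = e and g = g and T = T] b W N e g) auto
  moreover have "v < d * (\<alpha> / s)"
  proof -
    have "v * s < \<alpha> * d" using \<alpha>(1) d by (simp add: divide_less_eq)
    then have "v < \<alpha> * d / s" using s s0 by (simp add: less_divide_eq)
    then show ?thesis by (simp add: mult.commute)
  qed
  ultimately show False using v(1) by simp
qed

section \<open>The bound function: factorisation, comparison and maximum\<close>

lemma bound_fun_factored:
  "bound_fun w d t = (\<Sum>i\<in>UNIV. d i * ((t - 1) * (1 - w * t) / (((w + 1) * t - 1) * (t - d i * (t - 1)))))"
proof -
  have "- w * t\<^sup>2 + (w + 1) * t - 1 = (t - 1) * (1 - w * t)"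
    by (simp add: algebra_simps power2_eq_square)
  \<comment> \<open>The last factor equals \<open>(1 - d i) * t + d i\<close>, which lies between 1
    and \<open>t\<close> when \<open>d i\<close> is in the unit interval and
    \<open>t >= 1\<close>.\<close>
  moreover have "(w + 1) * (1 - d i) * t\<^sup>2 + ((w + 2) * d i - 1) * t - d i
      = ((w + 1) * t - 1) * (t - d i * (t - 1))" for i
    by (simp add: algebra_simps power2_eq_square)
  ultimately show ?thesis unfolding bound_fun_def by simp
qed

context
  fixes w :: real and d :: "'m::finite \<Rightarrow> real"
  assumes w: "0 < w" and d: "\<And>i. 0 < d i" "\<And>i. d i \<le> 1"
begin

lemma bound_fun_denom:
  assumes "1 \<le> t"
  shows "0 < (w + 1) * t - 1" "1 \<le> t - d i * (t - 1)"
proof -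
  have "0 < w * t" using assms w by simp
  then show "0 < (w + 1) * t - 1" using assms unfolding distrib_right by linarith
  have "d i * (t - 1) \<le> t - 1" using d assms by (intro mult_left_le_one_le) (auto intro: less_imp_le)
  then show "1 \<le> t - d i * (t - 1)" by simp
qed

lemma bound_fun_nonpos: "1 \<le> t \<Longrightarrow> 1 \<le> w * t \<Longrightarrow> bound_fun w d t \<le> 0"
  unfolding bound_fun_factored
proof (intro sum_nonpos mult_nonneg_nonpos divide_nonpos_pos mult_pos_pos)
  fix i assume t: "1 \<le> t" "1 \<le> w * t"
  show "0 < (w + 1) * t - 1" "0 < t - d i * (t - 1)" using bound_fun_denom[OF t(1)] less_le_trans zero_less_one by blast+
  show "0 \<le> t - 1" "1 - w * t \<le> 0" using t by auto
qed (use d in \<open>auto intro: less_imp_le\<close>)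

lemma bound_fun_pos: "1 < t \<Longrightarrow> w * t < 1 \<Longrightarrow> 0 < bound_fun w d t"
  unfolding bound_fun_factored
proof (intro sum_pos mult_pos_pos divide_pos_pos)
  fix i assume t: "1 < t" "w * t < 1"
  show "0 < (w + 1) * t - 1" "0 < t - d i * (t - 1)"
    using bound_fun_denom[OF less_imp_le[OF t(1)]] less_le_trans zero_less_one by blast+
qed (use d in auto)

text \<open>The summands are nonnegative in this range, and dropping the factor
  \<open>t - d i * (t - 1) >= 1\<close> from their denominators can only enlarge them.\<close>

lemma bound_fun_le:
  assumes t: "1 < t" "w * t < 1"
  shows "bound_fun w d t \<le> (\<Sum>i\<in>UNIV. d i) * ((t - 1) * (1 - w * t) / ((w + 1) * t - 1))"
  unfolding bound_fun_factored sum_distrib_right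
proof (intro sum_mono mult_left_mono divide_left_mono)
  fix i
  note D = bound_fun_denom[OF less_imp_le[OF t(1)]]
  show "(w + 1) * t - 1 \<le> ((w + 1) * t - 1) * (t - d i * (t - 1))"
    using mult_left_mono[OF D(2)[of i] less_imp_le[OF D(1)]] by simp
  show "0 < ((w + 1) * t - 1) * (t - d i * (t - 1)) * ((w + 1) * t - 1)"
    using D(1) D(2)[of i] by (intro mult_pos_pos) auto
qed (use t d in \<open>auto intro: less_imp_le\<close>)

text \<open>The function vanishes at 1, is positive strictly between 1 and \<open>1 / w\<close> and
  nonpositive beyond, so a maximum over the compact interval is a maximum over all
  \<open>t > 1\<close>. For \<open>w = 1\<close> the interval of positivity is empty.\<close>

lemma bound_fun_attains_max:
  assumes "w < 1"
  shows "\<exists>t>1. \<forall>s>1. bound_fun w d s \<le> bound_fun w d t"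
proof -
  define F where "F = bound_fun w d"
  have one: "1 < 1 / w" using assms w by simp
  have "continuous_on {1..1 / w} F"
    unfolding F_def bound_fun_factored[abs_def]
  proof (intro continuous_intros ballI)
    fix i t assume "t \<in> {1..1 / w}"
    then show "((w + 1) * t - 1) * (t - d i * (t - 1)) \<noteq> 0"
      using bound_fun_denom(1)[of t] bound_fun_denom(2)[of t i] by simp
  qed
  then obtain t where t: "t \<in> {1..1 / w}" "\<And>s. s \<in> {1..1 / w} \<Longrightarrow> F s \<le> F t"
    using continuous_attains_sup[of "{1..1 / w}" F] one by auto
  define u where "u = (1 + 1 / w) / 2"
  have u: "1 < u" "u < 1 / w" using one by (auto simp: u_def)
  then have "0 < F u" unfolding F_def using w by (intro bound_fun_pos) (auto simp: field_simps)
  then have Ft: "0 < F t" using t(2)[of u] u by simp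
  have "F 1 = 0" by (simp add: F_def bound_fun_factored)
  then have "t \<noteq> 1" using Ft by auto
  have "F s \<le> F t" if "1 < s" for s
  proof (cases "s \<le> 1 / w")
    case False
    then have "F s \<le> 0" unfolding F_def using that w by (intro bound_fun_nonpos) (auto simp: field_simps)
    then show ?thesis using Ft by simp
  qed (use that t(2) in simp)
  then show ?thesis using t(1) \<open>t \<noteq> 1\<close> unfolding F_def by (intro exI[of _ t]) auto
qed

end

text \<open>Only \<open>1 < t < 1 / w\<close> calls for the construction; for larger
  \<open>t\<close> the function is nonpositive and the dimension is not negative.\<close>

lemma SUP_bound_fun_le_hausdorff_dim:
  fixes N :: "real ^ 'm::finite \<Rightarrow> real" and W :: "'m \<Rightarrow> nat set"
  assumes b: "b \<ge> 2" and W: "\<And>i. W i \<subseteq> {0..<b}" "\<And>i. card (W i) \<ge> 2" and N: "is_norm N"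
    and e: "\<And>i. e i \<in> W i" and g: "g > 0" "\<And>k. int g * int b ^ k \<in> D" "\<And>i. (b - 1) dvd g * e i"
    and w: "0 < w"
  shows "(SUP t \<in> {1<..}. ereal (bound_fun w (\<lambda>i. digit_dim b (W i)) t))
    \<le> hausdorff_dim (singular_with D N w \<inter> missing_digit_product b W)"
proof (rule SUP_least)
  note d = digit_dim_bounds(1,2)[OF b W]
  fix t :: real assume "t \<in> {1<..}"
  then have t: "1 < t" by simp
  show "ereal (bound_fun w (\<lambda>i. digit_dim b (W i)) t)
    \<le> hausdorff_dim (singular_with D N w \<inter> missing_digit_product b W)"
  proof (cases "w * t < 1")
    case True
    have "ereal (bound_fun w (\<lambda>i. digit_dim b (W i)) t)
        \<le> ereal ((\<Sum>i\<in>UNIV. digit_dim b (W i)) * ((t - 1) * (1 - w * t) / ((w + 1) * t - 1)))"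
      unfolding ereal_less_eq by (rule bound_fun_le[OF w d t True])
    also have "\<dots> \<le> hausdorff_dim (singular_with D N w \<inter> missing_digit_product b W)"
      using hausdorff_dim_singular_ge_limit[OF b W N e g t less_imp_le[OF w] True] .
    finally show ?thesis .
  next
    case False
    then have "bound_fun w (\<lambda>i. digit_dim b (W i)) t \<le> 0"
      using bound_fun_nonpos[of w "\<lambda>i. digit_dim b (W i)" t, OF w d] t by simp
    then show ?thesis
      by (intro order_trans[OF _ hausdorff_dim_nonneg]) simp
  qed
qed

theorem theorem4p5:
  fixes b :: nat and W :: "'m::finite \<Rightarrow> nat set"
    and N :: "real ^ 'm \<Rightarrow> real" and N2 :: "real ^ 2 \<Rightarrow> real"
  assumes b: "b \<ge> 2"
    and digits: "\<And>i. W i \<subseteq> {0..<b}"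
    and two_digits: "\<And>i. card (W i) \<ge> 2"
    and N: "is_norm N"
    and N2: "is_norm N2"
  defines "F \<equiv> bound_fun (1 / real CARD('m)) (\<lambda>i. digit_dim b (W i))"
    and "K \<equiv> missing_digit_product b W"
    and "K2 \<equiv> missing_digit_product 3 (\<lambda>_ :: 2. {0, 2})"
  shows
    "(CARD('m) \<ge> 2 \<longrightarrow> (\<exists>t>1. \<forall>s>1. F s \<le> F t)) \<and>
     ((\<forall>i. 0 \<in> W i) \<longrightarrow>
        (SUP t \<in> {1<..}. ereal (F t)) \<le> hausdorff_dim (S_star_ary b N \<inter> K)) \<and>
     hausdorff_dim (S_star N2 \<inter> K2) \<ge> hausdorff_dim (S_star_ary 3 N2 \<inter> K2) \<and>
     hausdorff_dim (S_star_ary 3 N2 \<inter> K2) > ereal 0.1255 \<and>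
     (SUP t \<in> {1<..}. ereal (F t)) \<le> hausdorff_dim (S_star N \<inter> K)"
proof (intro conjI impI)
  have w: "0 < 1 / real CARD('m)" by simp
  note d = digit_dim_bounds(1,2)[OF b digits two_digits]
  show "\<exists>t>1. \<forall>s>1. F s \<le> F t" if "CARD('m) \<ge> 2"
    unfolding F_def using that by (intro bound_fun_attains_max w d) simp
  \<comment> \<open>Blocks of zeros with \<open>g = 1\<close>: the denominators stay powers of
    \<open>b\<close>.\<close>
  show "(SUP t \<in> {1<..}. ereal (F t)) \<le> hausdorff_dim (S_star_ary b N \<inter> K)" if "\<forall>i. 0 \<in> W i"
    unfolding F_def K_def S_star_ary_def
    by (rule SUP_bound_fun_le_hausdorff_dim[where e = "\<lambda>_. 0" and g = 1, OF b digits two_digits N _ _ _ _ w])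
       (use that in auto)
  have "\<exists>e. \<forall>i. e i \<in> W i"
    using two_digits by (intro choice allI) (metis card.empty ex_in_conv not_numeral_le_zero)
  then obtain e where e: "\<And>i. e i \<in> W i" by blast
  \<comment> \<open>Blocks of any admissible digits: \<open>g = b - 1\<close> clears the
    denominators of \<open>e i / (b - 1)\<close>, at the price of denominators
    \<open>(b - 1) * b ^ k\<close>.\<close>
  show "(SUP t \<in> {1<..}. ereal (F t)) \<le> hausdorff_dim (S_star N \<inter> K)"
    unfolding F_def K_def S_star_def
    by (rule SUP_bound_fun_le_hausdorff_dim[where e = e and g = "b - 1", OF b digits two_digits N e _ _ _ w])
       (use b in auto)
  have "S_star_ary 3 N2 \<subseteq> S_star N2"
    unfolding S_star_def S_star_ary_def by (rule singular_with_mono) simp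
  then show "hausdorff_dim (S_star_ary 3 N2 \<inter> K2) \<le> hausdorff_dim (S_star N2 \<inter> K2)"
    by (intro hausdorff_dim_mono) blast
  \<comment> \<open>For \<open>w = 1 / 2\<close> the quotient is largest over \<open>t > 1\<close>
    at \<open>t = 4 / 3\<close>, with value \<open>1 / 9\<close>; the two coordinates give the
    factor \<open>2 / 9\<close>.\<close>
  have "ereal ((\<Sum>i\<in>(UNIV::2 set). digit_dim 3 {0, 2}) * ((4 / 3 - 1) * (1 - 1 / 2 * (4 / 3)) / ((1 / 2 + 1) * (4 / 3) - 1)))
      \<le> hausdorff_dim (singular_with {int 3 ^ n | n :: nat. True} N2 (1 / 2) \<inter> missing_digit_product 3 (\<lambda>_. {0, 2}))"
    by (rule hausdorff_dim_singular_ge_limit[where e = "\<lambda>_. 0" and g = 1, OF _ _ _ N2]) auto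
  then have ge: "ereal (digit_dim 3 {0, 2} * (2 / 9)) \<le> hausdorff_dim (S_star_ary 3 N2 \<inter> K2)"
    by (simp add: S_star_ary_def K2_def mult.commute)
  have "0.6 < digit_dim 3 {0, 2}"
  proof -
    \<comment> \<open>From \<open>27 < 32\<close> the dimension of the Cantor set exceeds
      \<open>3 / 5\<close>, and \<open>3 / 5 * 2 / 9 = 2 / 15\<close> is above 0.1255.\<close>
    have "ln ((3::real) ^ 3) < ln (2 ^ 5)" by (subst ln_less_cancel_iff) auto
    then have "3 * ln 3 < 5 * ln (2::real)" by (simp only: ln_realpow of_nat_numeral)
    then show ?thesis by (simp add: digit_dim_def field_simps)
  qed
  then have "ereal 0.1255 < ereal (digit_dim 3 {0, 2} * (2 / 9))" by simp
  from this ge show "ereal 0.1255 < hausdorff_dim (S_star_ary 3 N2 \<inter> K2)" by (rule less_le_trans)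
qed

end
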